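(* Let $\Bbbk$ be an algebraically closed field of characteristic $0$, let $a,b\geq 1$ be integers, let $B:=\Bbbk[x_1,x_2,x_3,y_1,y_2,y_3,v]$ be the polynomial ring in $7$ variables (the ring of regular functions on $\Bbbk^7$), and let $D$ be the locally nilpotent derivation $$D:=x_1^{a}\frac{\partial}{\partial y_1}+ x_2^{a}\frac{\partial}{\partial y_2}+ x_3^{a}\frac{\partial}{\partial y_3}+ (y_1y_2y_3)^{b}\frac{\partial}{\partial v}$$ on $B$, with kernel $B^D$. Let $\theta:B\to B[T]$ be the $\Bbbk$-algebra homomorphism $\theta(f)=\sum_{k\ge 0}\frac{D^k(f)}{k!}T^k$, put $$h_i:=x_i^{(2b+1)a}\,\theta(v)|_{T=-y_i/x_i^a},\qquad i=1,2,3,$$ and let $$A:=\Bbbk[x_1,x_2,x_3,\;x_1^ay_2-x_2^ay_1,\;x_1^ay_3-x_3^ay_1,\;x_2^ay_3-x_3^ay_2,\;h_1,h_2,h_3]\subseteq B^D.$$ Then $B^D$ is equal to the ring of regular functions on the quasi-affine variety $\mathrm{Spec}(A)\setminus\mathcal{V}(x_1,x_2,x_3)$, that is, $B^D=\bigl(A:(x_1,x_2,x_3)^\infty\bigr)_{Q(A)}$, and $A$ is a separating algebra.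
   Context: The derivation $D$ corresponds to the action of the additive group $\mathbb{G}_a=(\Bbbk,+)$ on $\Bbbk^7$ given by $\theta$; the ring of invariants $B^{\mathbb{G}_a}$ coincides with $B^D=\ker D$. A subalgebra $A\subseteq B^D$ is a separating algebra if, for any two points $p,q\in\Bbbk^7$ such that $f(p)\neq f(q)$ for some $f\in B^D$, there is $g\in A$ with $g(p)\neq g(q)$. $Q(A)$ is the field of fractions of $A$. For an ideal $I$ of $A$, $(A:I^\infty)_{Q(A)}:=\{f\in Q(A)\mid \exists r\ge 1 \text{ such that } fI^r\subseteq A\}$, which is the ring of regular functions on $\mathrm{Spec}(A)\setminus\mathcal{V}(I)$; here $I=(x_1,x_2,x_3)A$. *)

theory Defs
  imports "HOL-Computational_Algebra.Computational_Algebra" "HOL-Library.Poly_Mapping"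
    "HOL-Library.Numeral_Type"
begin

section \<open>The polynomial ring in seven variables\<close>

text \<open>The index type \<open>3\<close> has the elements \<open>1\<close>, \<open>2\<close>, \<open>3\<close> (where \<open>3 = 0\<close>).\<close>

datatype var = Vx 3 | Vy 3 | Vv

text \<open>Some linear order on the variables is needed only for the library to provide the
  \<open>idom\<close> instance of the polynomial ring.\<close>

fun var_pos :: "var \<Rightarrow> int" where
  "var_pos (Vx i) = Rep_bit1 i"
| "var_pos (Vy i) = 3 + Rep_bit1 i"
| "var_pos Vv = 6"

lemma Rep_bit1_3: "0 \<le> Rep_bit1 (i :: 3)" "Rep_bit1 (i :: 3) < 3"
  using Rep_bit1[of i] by auto

lemma inj_var_pos: "inj var_pos"
proof (rule injI)
  fix u v assume "var_pos u = var_pos v"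
  then show "u = v"
    by (cases u; cases v) (auto simp: Rep_bit1_inject, (smt (verit) Rep_bit1_3)+)
qed

instantiation var :: linorder
begin
definition less_eq_var :: "var \<Rightarrow> var \<Rightarrow> bool" where "u \<le> v \<longleftrightarrow> var_pos u \<le> var_pos v"
definition less_var :: "var \<Rightarrow> var \<Rightarrow> bool" where "u < v \<longleftrightarrow> var_pos u < var_pos v"
instance
  by standard (auto simp: less_eq_var_def less_var_def dest: injD[OF inj_var_pos])
end

type_synonym monomial = "var \<Rightarrow>\<^sub>0 nat"
type_synonym 'k poly7 = "monomial \<Rightarrow>\<^sub>0 'k"

definition scalar :: "'k::zero \<Rightarrow> 'k poly7" where
  "scalar c = Poly_Mapping.single 0 c"

definition indet :: "var \<Rightarrow> 'k::zero_neq_one poly7" where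
  "indet u = Poly_Mapping.single (Poly_Mapping.single u 1) 1"

abbreviation var_x :: "3 \<Rightarrow> 'k::zero_neq_one poly7" where "var_x i \<equiv> indet (Vx i)"
abbreviation var_y :: "3 \<Rightarrow> 'k::zero_neq_one poly7" where "var_y i \<equiv> indet (Vy i)"
abbreviation var_v :: "'k::zero_neq_one poly7" where "var_v \<equiv> indet Vv"

text \<open>The value of a polynomial at a point of \<open>\<bbbk>\<^sup>7\<close>, a point being given by its coordinates.\<close>

definition eval_at :: "'k::comm_semiring_1 poly7 \<Rightarrow> (var \<Rightarrow> 'k) \<Rightarrow> 'k" where
  "eval_at f p = (\<Sum>m\<in>Poly_Mapping.keys f. Poly_Mapping.lookup f m *
     (\<Prod>u\<in>Poly_Mapping.keys m. p u ^ Poly_Mapping.lookup m u))"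

text \<open>The exponent subtraction below truncates only where the coefficient is zero.\<close>

definition partial_deriv :: "var \<Rightarrow> 'k::comm_semiring_1 poly7 \<Rightarrow> 'k poly7" where
  "partial_deriv u f = (\<Sum>m\<in>Poly_Mapping.keys f. Poly_Mapping.single (m - Poly_Mapping.single u 1)
     (of_nat (Poly_Mapping.lookup m u) * Poly_Mapping.lookup f m))"

section \<open>Subalgebras, ideals and rings of regular functions\<close>

definition subalgebra :: "'k::comm_ring_1 poly7 set \<Rightarrow> bool" where
  "subalgebra A \<longleftrightarrow> (\<forall>c. scalar c \<in> A) \<and> (\<forall>f\<in>A. \<forall>g\<in>A. f + g \<in> A \<and> f * g \<in> A)"

text \<open>Ideals of a subring \<open>A\<close>, which is given as a set.\<close>

definition ideal_of :: "'r::comm_ring_1 set \<Rightarrow> 'r set \<Rightarrow> bool" where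
  "ideal_of A J \<longleftrightarrow> J \<subseteq> A \<and> 0 \<in> J \<and> (\<forall>f\<in>J. \<forall>g\<in>J. f + g \<in> J) \<and> (\<forall>c\<in>A. \<forall>f\<in>J. c * f \<in> J)"

abbreviation ideal_gen :: "'r::comm_ring_1 set \<Rightarrow> 'r set \<Rightarrow> 'r set" where
  "ideal_gen A S \<equiv> ideal_of A hull S"

fun ideal_power :: "'r::comm_ring_1 set \<Rightarrow> 'r set \<Rightarrow> nat \<Rightarrow> 'r set" where
  "ideal_power A I 0 = A"
| "ideal_power A I (Suc r) = ideal_gen A {f * g | f g. f \<in> I \<and> g \<in> ideal_power A I r}"

text \<open>For a subring \<open>A\<close> of a domain \<open>R\<close>, the field \<open>Q(A)\<close> is taken inside the fraction field
  of \<open>R\<close>.  The set \<open>colon_infinity A I\<close> is \<open>(A : I\<^sup>\<infinity>)\<close> in \<open>Q(A)\<close>, the ring of regular functions on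
  \<open>Spec(A) - V(I)\<close>.\<close>

definition quotient_field :: "'r::idom set \<Rightarrow> 'r fract set" where
  "quotient_field A = {Fract p q | p q. p \<in> A \<and> q \<in> A \<and> q \<noteq> 0}"

definition colon_infinity :: "'r::idom set \<Rightarrow> 'r set \<Rightarrow> 'r fract set" where
  "colon_infinity A I =
     {f \<in> quotient_field A. \<exists>r\<ge>1. \<forall>g\<in>ideal_power A I r. f * to_fract g \<in> to_fract ` A}"

definition separating_algebra :: "'k::comm_ring_1 poly7 set \<Rightarrow> 'k poly7 set \<Rightarrow> bool" where
  "separating_algebra R A \<longleftrightarrow> subalgebra A \<and> A \<subseteq> R \<and>
     (\<forall>p q. (\<exists>f\<in>R. eval_at f p \<noteq> eval_at f q) \<longrightarrow> (\<exists>g\<in>A. eval_at g p \<noteq> eval_at g q))"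

section \<open>The derivation and its kernel\<close>

definition deriv_D :: "nat \<Rightarrow> nat \<Rightarrow> 'k::comm_semiring_1 poly7 \<Rightarrow> 'k poly7" where
  "deriv_D a b f = var_x 1 ^ a * partial_deriv (Vy 1) f + var_x 2 ^ a * partial_deriv (Vy 2) f + var_x 3 ^ a * partial_deriv (Vy 3) f
     + (var_y 1 * var_y 2 * var_y 3) ^ b * partial_deriv Vv f"

definition kernel_D :: "nat \<Rightarrow> nat \<Rightarrow> 'k::comm_semiring_1 poly7 set" where
  "kernel_D a b = {f. deriv_D a b f = 0}"

lemma indet_power: "indet u ^ n = (Poly_Mapping.single (Poly_Mapping.single u n) 1 :: 'k::comm_semiring_1 poly7)"
proof (induction n)
  case (Suc n)
  have "indet u ^ Suc n = indet u * (Poly_Mapping.single (Poly_Mapping.single u n) 1 :: 'k poly7)"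
    using Suc by simp
  also have "\<dots> = Poly_Mapping.single (Poly_Mapping.single u (Suc n)) 1"
    by (simp add: indet_def mult_single flip: single_add)
  finally show ?case .
qed simp

lemma keys_partial_deriv:
  assumes "m' \<in> Poly_Mapping.keys (partial_deriv u f)"
  obtains m where "m \<in> Poly_Mapping.keys f" "Poly_Mapping.lookup m u > 0"
    "m' = m - Poly_Mapping.single u 1"
proof -
  from assms have "(\<Sum>m\<in>Poly_Mapping.keys f. Poly_Mapping.lookup
      (Poly_Mapping.single (m - Poly_Mapping.single u 1)
        (of_nat (Poly_Mapping.lookup m u) * Poly_Mapping.lookup f m)) m') \<noteq> 0"
    by (simp add: partial_deriv_def in_keys_iff lookup_sum)
  then obtain m where "m \<in> Poly_Mapping.keys f"
    "Poly_Mapping.lookup (Poly_Mapping.single (m - Poly_Mapping.single u 1)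
        (of_nat (Poly_Mapping.lookup m u) * Poly_Mapping.lookup f m)) m' \<noteq> 0"
    by (rule sum.not_neutral_contains_not_neutral)
  then show thesis
    by (intro that[of m]) (auto simp: lookup_single when_def intro!: gr0I split: if_splits)
qed

lemma keys_single_mult:
  assumes "m' \<in> Poly_Mapping.keys (Poly_Mapping.single n c * f)"
  obtains m where "m \<in> Poly_Mapping.keys f" "m' = n + m"
  using assms keys_mult[of "Poly_Mapping.single n c" f]
  by (auto split: if_splits)

lemma keys_deriv_D:
  assumes "m' \<in> Poly_Mapping.keys (deriv_D a b f)"
  obtains m i where "m \<in> Poly_Mapping.keys f" "i \<in> {1, 2, 3}" "Poly_Mapping.lookup m (Vy i) > 0"
      "m' = Poly_Mapping.single (Vx i) a + (m - Poly_Mapping.single (Vy i) 1)"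
  | m where "m \<in> Poly_Mapping.keys f" "Poly_Mapping.lookup m Vv > 0"
      "m' = Poly_Mapping.single (Vy 1) b + Poly_Mapping.single (Vy 2) b
        + Poly_Mapping.single (Vy 3) b + (m - Poly_Mapping.single Vv 1)"
proof -
  note that' = that
  have x_case: thesis
    if i: "i \<in> {1, 2, 3}" and "m' \<in> Poly_Mapping.keys (var_x i ^ a * partial_deriv (Vy i) f)" for i
  proof -
    from that(2) obtain m1 where m1: "m1 \<in> Poly_Mapping.keys (partial_deriv (Vy i) f)"
      "m' = Poly_Mapping.single (Vx i) a + m1"
      unfolding indet_power by (rule keys_single_mult)
    from m1(1) show thesis
      by (rule keys_partial_deriv) (use i m1(2) in \<open>auto intro: that'(1)\<close>)
  qed
  have v_case: thesis
    if "m' \<in> Poly_Mapping.keys ((var_y 1 * var_y 2 * var_y 3) ^ b * partial_deriv Vv f)"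
  proof -
    have "(var_y 1 * var_y 2 * var_y 3) ^ b = (Poly_Mapping.single (Poly_Mapping.single (Vy 1) b
        + Poly_Mapping.single (Vy 2) b + Poly_Mapping.single (Vy 3) b) 1 :: 'a poly7)"
      by (simp add: power_mult_distrib indet_power mult_single)
    with that obtain m1 where m1: "m1 \<in> Poly_Mapping.keys (partial_deriv Vv f)"
      "m' = Poly_Mapping.single (Vy 1) b + Poly_Mapping.single (Vy 2) b
        + Poly_Mapping.single (Vy 3) b + m1"
      by (metis keys_single_mult)
    from m1(1) show thesis
      by (rule keys_partial_deriv) (use m1(2) in \<open>auto intro: that'(2)\<close>)
  qed
  have "m' \<in> Poly_Mapping.keys (var_x 1 ^ a * partial_deriv (Vy 1) f)
      \<union> Poly_Mapping.keys (var_x 2 ^ a * partial_deriv (Vy 2) f)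
      \<union> Poly_Mapping.keys (var_x 3 ^ a * partial_deriv (Vy 3) f)
      \<union> Poly_Mapping.keys ((var_y 1 * var_y 2 * var_y 3) ^ b * partial_deriv Vv f)"
    using assms unfolding deriv_D_def
    by (auto dest!: subsetD[OF keys_add])
  then show thesis using x_case v_case by blast
qed

lemma deriv_D_0 [simp]: "deriv_D a b 0 = 0"
  by (simp add: deriv_D_def partial_deriv_def)

lemma deriv_D_locally_nilpotent: "finite {k. (deriv_D a b ^^ k) f \<noteq> 0}"
proof -
  define w where "w m = Poly_Mapping.lookup m (Vy 1) + Poly_Mapping.lookup m (Vy 2)
    + Poly_Mapping.lookup m (Vy 3) + (3 * b + 1) * Poly_Mapping.lookup m Vv" for m :: monomial
  have step: "\<exists>m\<in>Poly_Mapping.keys g. w m = Suc (w m')"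
    if "m' \<in> Poly_Mapping.keys (deriv_D a b g)" for m' and g :: "'a poly7"
    using that
  proof (cases rule: keys_deriv_D)
    case (1 m i)
    then show ?thesis
      by (intro bexI[of _ m]) (auto simp: w_def lookup_add lookup_minus lookup_single)
  next
    case (2 m)
    then obtain k where "Poly_Mapping.lookup m Vv = Suc k" by (auto simp: gr0_conv_Suc)
    with 2 show ?thesis
      by (intro bexI[of _ m]) (auto simp: w_def lookup_add lookup_minus lookup_single)
  qed
  have iter: "\<exists>m\<in>Poly_Mapping.keys f. w m = w m' + k"
    if "m' \<in> Poly_Mapping.keys ((deriv_D a b ^^ k) f)" for m' k
    using that
  proof (induction k arbitrary: m')
    case (Suc k)
    then obtain m1 where "m1 \<in> Poly_Mapping.keys ((deriv_D a b ^^ k) f)" "w m1 = Suc (w m')"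
      using step by fastforce
    with Suc.IH show ?case by fastforce
  qed auto
  have "{k. (deriv_D a b ^^ k) f \<noteq> 0} \<subseteq> {..Max (w ` Poly_Mapping.keys f)}"
  proof
    fix k assume "k \<in> {k. (deriv_D a b ^^ k) f \<noteq> 0}"
    then obtain m' where "m' \<in> Poly_Mapping.keys ((deriv_D a b ^^ k) f)"
      by (auto simp: poly_mapping_eq_iff fun_eq_iff in_keys_iff)
    then obtain m where "m \<in> Poly_Mapping.keys f" "w m = w m' + k" using iter by blast
    then have "k \<le> w m" by simp
    moreover have "w m \<le> Max (w ` Poly_Mapping.keys f)"
      using \<open>m \<in> Poly_Mapping.keys f\<close> by (intro Max_ge) auto
    ultimately show "k \<in> {..Max (w ` Poly_Mapping.keys f)}" by simp
  qed
  then show ?thesis using finite_subset by blast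
qed

definition theta :: "nat \<Rightarrow> nat \<Rightarrow> 'k::field_char_0 poly7 \<Rightarrow> 'k poly7 poly" where
  "theta a b f =
     (\<Sum>k | (deriv_D a b ^^ k) f \<noteq> 0. monom (scalar (1 / fact k) * (deriv_D a b ^^ k) f) k)"

lemma coeff_theta: "coeff (theta a b f) k = scalar (1 / fact k) * (deriv_D a b ^^ k) f"
  by (auto simp: theta_def coeff_sum deriv_D_locally_nilpotent)

text \<open>\<open>h_fract\<close> is the defining expression of \<open>h\<^sub>i\<close> in the fraction field, and \<open>h_poly\<close> is
  the polynomial it represents (\<open>to_fract_h_poly\<close> below).\<close>

definition h_fract :: "nat \<Rightarrow> nat \<Rightarrow> 3 \<Rightarrow> 'k::field_char_0 poly7 fract" where
  "h_fract a b i = to_fract (var_x i ^ ((2 * b + 1) * a)) *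
     poly (map_poly to_fract (theta a b var_v)) (- Fract (var_y i) (var_x i ^ a))"

definition h_poly :: "nat \<Rightarrow> nat \<Rightarrow> 3 \<Rightarrow> 'k::field_char_0 poly7" where
  "h_poly a b i = (THE g. to_fract g = h_fract a b i)"

lemma indet_power_dvd:
  assumes "\<And>m. m \<in> Poly_Mapping.keys f \<Longrightarrow> e \<le> Poly_Mapping.lookup m u"
  shows "indet u ^ e dvd (f :: 'k::comm_semiring_1 poly7)"
proof -
  have "indet u ^ e dvd Poly_Mapping.single m (Poly_Mapping.lookup f m)"
    if "m \<in> Poly_Mapping.keys f" for m
  proof
    have "Poly_Mapping.single u e + (m - Poly_Mapping.single u e) = m"
      using assms[OF that]
      by (intro poly_mapping_eqI) (auto simp: lookup_add lookup_minus lookup_single when_def)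
    then show "Poly_Mapping.single m (Poly_Mapping.lookup f m)
        = indet u ^ e * Poly_Mapping.single (m - Poly_Mapping.single u e) (Poly_Mapping.lookup f m)"
      by (simp add: indet_power mult_single)
  qed
  then have "indet u ^ e dvd
      (\<Sum>m\<in>Poly_Mapping.keys f. Poly_Mapping.single m (Poly_Mapping.lookup f m))"
    by (rule dvd_sum)
  also have "(\<Sum>m\<in>Poly_Mapping.keys f. Poly_Mapping.single m (Poly_Mapping.lookup f m)) = f"
    by (rule poly_mapping_eqI)
       (auto simp: lookup_sum lookup_single when_def in_keys_iff)
  finally show ?thesis .
qed

lemma keys_deriv_D_power_v:
  fixes m :: monomial
  assumes "m \<in> Poly_Mapping.keys ((deriv_D a b ^^ Suc k) (var_v :: 'k::comm_semiring_1 poly7))"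
  defines "e i \<equiv> b - Poly_Mapping.lookup m (Vy i)"
  shows "Poly_Mapping.lookup m Vv = 0"
    and "\<forall>i\<in>{1, 2, 3}. Poly_Mapping.lookup m (Vy i) \<le> b \<and> Poly_Mapping.lookup m (Vx i) = a * e i"
    and "e 1 + e 2 + e 3 = k"
  unfolding atomize_conj using assms(1) unfolding e_def
proof (induction k arbitrary: m)
  case 0
  then show ?case
    by (auto elim!: keys_deriv_D simp: indet_def lookup_add lookup_minus lookup_single when_def
        split: if_splits)
next
  case (Suc k)
  from Suc.prems have "m \<in> Poly_Mapping.keys (deriv_D a b ((deriv_D a b ^^ Suc k) (var_v :: 'k poly7)))"
    by simp
  then show ?case
  proof (cases rule: keys_deriv_D)
    case (1 m1 i)
    then obtain l where l: "Poly_Mapping.lookup m1 (Vy i) = Suc l" by (auto simp: gr0_conv_Suc)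
    have IH: "Poly_Mapping.lookup m1 Vv = 0"
      "Poly_Mapping.lookup m1 (Vy j) \<le> b"
      "Poly_Mapping.lookup m1 (Vx j) = a * (b - Poly_Mapping.lookup m1 (Vy j))"
      if "j \<in> {1, 2, 3}" for j
      using Suc.IH[OF 1(1)] that by blast+
    have IH_sum: "(b - Poly_Mapping.lookup m1 (Vy 1)) + (b - Poly_Mapping.lookup m1 (Vy 2))
        + (b - Poly_Mapping.lookup m1 (Vy 3)) = k"
      using Suc.IH[OF 1(1)] by blast
    have m: "Poly_Mapping.lookup m Vv = 0"
      "Poly_Mapping.lookup m (Vy j) = (if j = i then l else Poly_Mapping.lookup m1 (Vy j))"
      "Poly_Mapping.lookup m (Vx j) = (if j = i then a else 0) + Poly_Mapping.lookup m1 (Vx j)" for j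
      using IH(1)[OF 1(2)] l
      by (auto simp: 1(4) lookup_add lookup_minus lookup_single when_def)
    have bl: "b - l = Suc (b - Suc l)" using IH(2)[OF 1(2)] l by simp
    have "Poly_Mapping.lookup m (Vy j) \<le> b
        \<and> Poly_Mapping.lookup m (Vx j) = a * (b - Poly_Mapping.lookup m (Vy j))"
      if "j \<in> {1, 2, 3}" for j
      using IH(2,3)[OF that] l bl by (auto simp: m)
    moreover have "(b - Poly_Mapping.lookup m (Vy 1)) + (b - Poly_Mapping.lookup m (Vy 2))
        + (b - Poly_Mapping.lookup m (Vy 3)) = Suc k"
    proof -
      from 1(2) consider "i = 1" | "i = 2" | "i = 3" by blast
      then show ?thesis by cases (use IH_sum l bl in \<open>simp_all add: m\<close>)
    qed
    ultimately show ?thesis using m(1) by blast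
  next
    case (2 m1)
    with Suc.IH[OF 2(1)] show ?thesis by simp
  qed
qed

lemma h_fract_in_range: "h_fract a b i \<in> range (to_fract :: 'k::field_char_0 poly7 \<Rightarrow> _)"
proof -
  define N where "N = (2 * b + 1) * a"
  define X where "X = (to_fract (var_x i) :: 'k poly7 fract)"
  define c where "c k = coeff (theta a b (var_v :: 'k poly7)) k" for k
  have i: "i \<in> {1, 2, 3}"
  proof (cases i rule: bit1_cases)
    case (of_int z)
    then have "z \<in> {0, 1, 2}" by auto
    with of_int(1) show ?thesis by auto
  qed
  have "Poly_Mapping.keys (var_x i :: 'k poly7) \<noteq> Poly_Mapping.keys (0 :: 'k poly7)"
    by (simp add: indet_def)
  then have X0: "X \<noteq> 0" by (auto simp: X_def)
  have to_fract_power: "to_fract (f ^ n) = to_fract f ^ n" for f :: "'k poly7" and n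
    by (induction n) auto
  have dvd: "var_x i ^ (a * k) dvd var_x i ^ N * c k" for k
  proof (cases "a * k \<le> N")
    case True
    then show ?thesis by (simp add: le_imp_power_dvd)
  next
    case False
    then have "k \<noteq> 0" by (cases k) auto
    then obtain k' where k': "k = Suc k'" by (cases k) auto
    have "var_x i ^ (a * (k' - 2 * b)) dvd (deriv_D a b ^^ k) (var_v :: 'k poly7)"
    proof (rule indet_power_dvd)
      fix m assume "m \<in> Poly_Mapping.keys ((deriv_D a b ^^ k) (var_v :: 'k poly7))"
      from keys_deriv_D_power_v[OF this[unfolded k']]
      have "k' - 2 * b \<le> b - Poly_Mapping.lookup m (Vy i)"
        "Poly_Mapping.lookup m (Vx i) = a * (b - Poly_Mapping.lookup m (Vy i))"
        using i by auto
      then show "a * (k' - 2 * b) \<le> Poly_Mapping.lookup m (Vx i)" by simp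
    qed
    then have "var_x i ^ N * var_x i ^ (a * (k' - 2 * b)) dvd var_x i ^ N * c k"
      unfolding c_def coeff_theta by (intro mult_dvd_mono dvd_mult) auto
    moreover have "a * k \<le> N + a * (k' - 2 * b)"
    proof -
      have "a * k \<le> a * (2 * b + 1 + (k' - 2 * b))" using k' by (intro mult_left_mono) auto
      also have "\<dots> = N + a * (k' - 2 * b)" by (simp add: N_def algebra_simps)
      finally show ?thesis .
    qed
    then have "var_x i ^ (a * k) dvd
        (var_x i ^ N * var_x i ^ (a * (k' - 2 * b)) :: 'k poly7)"
      unfolding power_add[symmetric] by (rule le_imp_power_dvd)
    ultimately show ?thesis by (blast intro: dvd_trans)
  qed
  then have "\<forall>k. \<exists>g. var_x i ^ N * c k = var_x i ^ (a * k) * g"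
    unfolding dvd_def by blast
  from choice[OF this] obtain g where g: "\<And>k. var_x i ^ N * c k = var_x i ^ (a * k) * g k"
    by blast
  have "h_fract a b i = X ^ N *
      poly (map_poly to_fract (theta a b var_v)) (- (to_fract (var_y i) / X ^ a))"
    by (simp only: h_fract_def N_def X_def Fract_conv_to_fract to_fract_power)
  also have "\<dots> = (\<Sum>k\<le>degree (map_poly to_fract (theta a b (var_v :: 'k poly7))).
      X ^ N * (to_fract (c k) * (- (to_fract (var_y i) / X ^ a)) ^ k))"
    by (simp only: poly_altdef sum_distrib_left coeff_map_poly to_fract_0 c_def)
  also have "\<dots> = (\<Sum>k\<le>degree (map_poly to_fract (theta a b (var_v :: 'k poly7))).
      to_fract (g k * (- var_y i) ^ k))"
  proof (rule sum.cong)
    fix k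
    have "X ^ N * to_fract (c k) = X ^ (a * k) * to_fract (g k)"
      using arg_cong[OF g[of k], of to_fract] by (simp add: to_fract_power X_def)
    moreover have "(- (to_fract (var_y i) / X ^ a)) ^ k = to_fract ((- var_y i) ^ k) / X ^ (a * k)"
      by (simp only: minus_divide_left power_divide power_mult to_fract_power to_fract_uminus)
    moreover have "X ^ (a * k) \<noteq> 0" using X0 by simp
    ultimately show "X ^ N * (to_fract (c k) * (- (to_fract (var_y i) / X ^ a)) ^ k)
        = to_fract (g k * (- var_y i) ^ k)"
      by (simp only: to_fract_mult mult.assoc[symmetric] times_divide_eq_right)
         (simp only: mult.assoc nonzero_mult_div_cancel_left not_False_eq_True)
  qed simp
  also have "\<dots> = to_fract (\<Sum>k\<le>degree (map_poly to_fract (theta a b (var_v :: 'k poly7))).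
      g k * (- var_y i) ^ k)"
    by (simp only: to_fract_sum)
  finally show ?thesis by blast
qed

lemma to_fract_h_poly: "to_fract (h_poly a b i :: 'k::field_char_0 poly7) = h_fract a b i"
proof -
  obtain g :: "'k poly7" where g: "h_fract a b i = to_fract g"
    by (rule rangeE[OF h_fract_in_range])
  have "h_poly a b i = g"
    unfolding h_poly_def g by (rule the_equality) (simp_all only: to_fract_eq_iff)
  then show ?thesis by (simp only: g)
qed

definition algebra_A :: "nat \<Rightarrow> nat \<Rightarrow> 'k::field_char_0 poly7 set" where
  "algebra_A a b = subalgebra hull
     {var_x 1, var_x 2, var_x 3,
      var_x 1 ^ a * var_y 2 - var_x 2 ^ a * var_y 1,
      var_x 1 ^ a * var_y 3 - var_x 3 ^ a * var_y 1,
      var_x 2 ^ a * var_y 3 - var_x 3 ^ a * var_y 2,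
      h_poly a b 1, h_poly a b 2, h_poly a b 3}"

end

theory Submission
  imports Defs
begin

text \<open>Where some \<open>x\<^sub>i\<close> is invertible, \<open>y\<^sub>i\<close> is a slice up to a unit, so every \<open>f \<in> B\<^sup>D\<close> satisfies
  \<open>x\<^sub>i\<^sup>M f \<in> A\<close> for large \<open>M\<close>.  This gives \<open>B\<^sup>D \<subseteq> (A : I\<^sup>\<infinity>)\<close> and the separation of points with
  \<open>x \<noteq> 0\<close>.  Conversely \<open>(A : I\<^sup>\<infinity>)\<close> lies in \<open>B[1/x\<^sub>1] \<inter> B[1/x\<^sub>2] = B\<close>, and \<open>D\<close> vanishes on it.
  Points with \<open>x = 0\<close> need no separation: a term \<open>c y\<^sup>\<alpha>\<close> with \<open>\<alpha> \<noteq> 0\<close> in a kernel element would force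
  nonzero terms of arbitrarily large degree in \<open>v\<close>, so \<open>B\<^sup>D \<subseteq> \<bbbk> + (x\<^sub>1, x\<^sub>2, x\<^sub>3)B\<close>.\<close>

section \<open>Coefficients and partial derivatives\<close>

lemma UNIV_3_eq: "(UNIV :: 3 set) = {1, 2, 3}"
proof -
  have "i \<in> {1, 2, 3}" for i :: 3
  proof (cases i rule: bit1_cases)
    case (of_int z)
    then have "z \<in> {0, 1, 2}" by auto
    with of_int(1) show ?thesis by auto
  qed
  then show ?thesis by blast
qed

lemma sum_UNIV_3: "(\<Sum>i\<in>UNIV. f (i :: 3)) = f 1 + f 2 + f 3"
  unfolding UNIV_3_eq by (simp add: add.assoc)

lemma poly7_eq_sum_single:
  "f = (\<Sum>m\<in>Poly_Mapping.keys f. Poly_Mapping.single m (Poly_Mapping.lookup f m))"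
  by (rule poly_mapping_eqI) (auto simp: lookup_sum lookup_single when_def in_keys_iff)

lemma poly7_induct [case_names zero single add]:
  assumes "P 0" and "\<And>m c. P (Poly_Mapping.single m c)" and "\<And>f g. P f \<Longrightarrow> P g \<Longrightarrow> P (f + g)"
  shows "P (f :: 'a \<Rightarrow>\<^sub>0 'b::comm_monoid_add)"
proof -
  have "P (\<Sum>m\<in>M. Poly_Mapping.single m (Poly_Mapping.lookup f m))" for M
    by (induction M rule: infinite_finite_induct) (auto intro: assms)
  then show ?thesis using poly7_eq_sum_single[of f] by metis
qed

lemma lookup_single_mult_add:
  "Poly_Mapping.lookup (Poly_Mapping.single m c * f) (m + n) = c * Poly_Mapping.lookup f n"
  for m :: "'a \<Rightarrow>\<^sub>0 nat" and f :: "('a \<Rightarrow>\<^sub>0 nat) \<Rightarrow>\<^sub>0 'b::comm_semiring_1"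
  by (induction f rule: poly7_induct)
    (auto simp: mult_single lookup_single when_def distrib_left lookup_add)

lemma lookup_single_mult_eq_0:
  fixes m :: monomial
  assumes "Poly_Mapping.lookup n u < Poly_Mapping.lookup m u"
  shows "Poly_Mapping.lookup (Poly_Mapping.single m c * f) n = (0 :: 'k::comm_semiring_1)"
proof (rule ccontr)
  assume "Poly_Mapping.lookup (Poly_Mapping.single m c * f) n \<noteq> 0"
  then have "n \<in> Poly_Mapping.keys (Poly_Mapping.single m c * f)" by (simp add: in_keys_iff)
  then obtain n' where "n = m + n'" by (rule keys_single_mult)
  with assms show False by (simp add: lookup_add)
qed

text \<open>Only \<open>m + Poly_Mapping.single u 1\<close> can contribute to \<open>m\<close>:
  exponent subtraction truncates just when the exponent of \<open>u\<close> is zero, and then the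
  coefficient factor kills the term.\<close>

lemma lookup_partial_deriv:
  "Poly_Mapping.lookup (partial_deriv u f) m =
     of_nat (Suc (Poly_Mapping.lookup m u)) * Poly_Mapping.lookup f (m + Poly_Mapping.single u 1)"
  (is "_ = ?r")
proof -
  let ?n = "m + Poly_Mapping.single u (1 :: nat)"
  have eq: "Poly_Mapping.lookup (Poly_Mapping.single (n - Poly_Mapping.single u 1)
      (of_nat (Poly_Mapping.lookup n u) * Poly_Mapping.lookup f n)) m
      = (if n = ?n then of_nat (Poly_Mapping.lookup n u) * Poly_Mapping.lookup f n else 0)" for n
  proof (cases "Poly_Mapping.lookup n u = 0")
    case True
    then have "n \<noteq> ?n" by (auto simp: lookup_add)
    with True show ?thesis by simp
  next
    case False
    then have "n - Poly_Mapping.single u 1 + Poly_Mapping.single u 1 = n"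
      by (intro poly_mapping_eqI) (auto simp: lookup_add lookup_minus lookup_single when_def)
    then have "n - Poly_Mapping.single u 1 = m \<longleftrightarrow> n = ?n"
      by (metis add_diff_cancel_right')
    then show ?thesis by (simp add: lookup_single when_def)
  qed
  have "Poly_Mapping.lookup (partial_deriv u f) m = (\<Sum>n\<in>Poly_Mapping.keys f.
      if n = ?n then of_nat (Poly_Mapping.lookup n u) * Poly_Mapping.lookup f n else 0)"
    unfolding partial_deriv_def lookup_sum eq ..
  also have "\<dots> = ?r"
    by (auto simp: sum.delta' in_keys_iff lookup_add)
  finally show ?thesis .
qed

lemma partial_deriv_single:
  "partial_deriv u (Poly_Mapping.single m c) =
     Poly_Mapping.single (m - Poly_Mapping.single u 1) (of_nat (Poly_Mapping.lookup m u) * c)"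
  by (auto simp: partial_deriv_def)

lemma partial_deriv_add: "partial_deriv u (f + g) = partial_deriv u f + partial_deriv u g"
  by (rule poly_mapping_eqI) (simp add: lookup_partial_deriv lookup_add distrib_left)

lemma partial_deriv_0 [simp]: "partial_deriv u 0 = 0"
  by (simp add: partial_deriv_def)

text \<open>One summand of the Leibniz rule on monomials. Regrouping the subtraction onto
  \<open>m\<close> requires that \<open>u\<close> occur in \<open>m\<close>; otherwise both sides
  vanish through their coefficients.\<close>

lemma partial_deriv_single_mult_single:
  fixes m n :: monomial and c d :: "'k::comm_semiring_1"
  shows "Poly_Mapping.single (m + n - Poly_Mapping.single u 1) (of_nat (Poly_Mapping.lookup m u) * c * d)
    = partial_deriv u (Poly_Mapping.single m c) * Poly_Mapping.single n d"
proof (cases "Poly_Mapping.lookup m u = 0")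
  case False
  then have "m + n - Poly_Mapping.single u 1 = m - Poly_Mapping.single u 1 + n"
    by (intro poly_mapping_eqI) (auto simp: lookup_add lookup_minus lookup_single when_def)
  then show ?thesis by (simp add: partial_deriv_single mult_single)
qed (simp add: partial_deriv_single)

lemma partial_deriv_mult:
  "partial_deriv u (f * g) = partial_deriv u f * g + f * partial_deriv u (g :: 'k::comm_semiring_1 poly7)"
proof (induction f rule: poly7_induct)
  case (single m c)
  show ?case
  proof (induction g rule: poly7_induct)
    case (single n d)
    show ?case
      using partial_deriv_single_mult_single[of m n u c d] partial_deriv_single_mult_single[of n m u d c]
      by (simp add: mult_single partial_deriv_single[of _ "m + n"] lookup_add distrib_right
          distrib_left single_add ac_simps)
  qed (simp_all add: partial_deriv_add distrib_left add_ac)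
qed (simp_all add: partial_deriv_add distrib_right add_ac)

lemma partial_deriv_indet:
  "partial_deriv u (indet w :: 'k::comm_semiring_1 poly7) = (if u = w then 1 else 0)"
  by (simp add: indet_def partial_deriv_single lookup_single)

lemma partial_deriv_scalar: "partial_deriv u (scalar c) = 0"
  by (simp add: scalar_def partial_deriv_single)

section \<open>Algebraic rules for the derivation \<open>D\<close>\<close>

lemma deriv_D_add: "deriv_D a b (f + g) = deriv_D a b f + deriv_D a b g"
  by (simp add: deriv_D_def partial_deriv_add algebra_simps)

lemma deriv_D_mult: "deriv_D a b (f * g) = deriv_D a b f * g + f * deriv_D a b g"
  by (simp add: deriv_D_def partial_deriv_mult algebra_simps)

lemma deriv_D_scalar [simp]: "deriv_D a b (scalar c) = 0"
  by (simp add: deriv_D_def partial_deriv_scalar)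

lemma deriv_D_1 [simp]: "deriv_D a b 1 = 0"
  using deriv_D_scalar[of a b 1] by (simp add: scalar_def)

lemma deriv_D_x [simp]: "deriv_D a b (var_x i) = 0"
  by (simp add: deriv_D_def partial_deriv_indet)

lemma deriv_D_y [simp]: "deriv_D a b (var_y i) = var_x i ^ a"
proof -
  have "i \<in> {1, 2, 3}" using UNIV_3_eq by blast
  then show ?thesis by (auto simp: deriv_D_def partial_deriv_indet)
qed

lemma deriv_D_v [simp]: "deriv_D a b var_v = (var_y 1 * var_y 2 * var_y 3) ^ b"
  by (simp add: deriv_D_def partial_deriv_indet)

lemma deriv_D_x_power [simp]: "deriv_D a b (var_x i ^ n) = 0"
  by (induction n) (simp_all add: deriv_D_mult)

lemma deriv_D_x_power_mult: "deriv_D a b (var_x i ^ n * f) = var_x i ^ n * deriv_D a b f"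
  by (simp add: deriv_D_mult)

lemma deriv_D_minus: "deriv_D a b (- f) = - deriv_D a b (f :: 'k::comm_ring_1 poly7)"
  using deriv_D_add[of a b f "- f"] by (simp add: add_eq_0_iff)

lemma deriv_D_diff: "deriv_D a b (f - g) = deriv_D a b f - deriv_D a b (g :: 'k::comm_ring_1 poly7)"
  using deriv_D_add[of a b f "- g"] by (simp add: deriv_D_minus)

lemma deriv_D_sum: "deriv_D a b (\<Sum>i\<in>I. f i) = (\<Sum>i\<in>I. deriv_D a b (f i))"
  by (induction I rule: infinite_finite_induct) (simp_all add: deriv_D_add)

lemma indet_neq_0 [simp]: "(indet u :: 'k::comm_semiring_1 poly7) \<noteq> 0"
proof -
  have "Poly_Mapping.keys (indet u :: 'k poly7) \<noteq> Poly_Mapping.keys (0 :: 'k poly7)"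
    by (simp add: indet_def)
  then show ?thesis by metis
qed

section \<open>Kernel elements are constant on the common zero set of the x-variables\<close>

text \<open>Exponents are functions on the indices, so that passing to a neighbouring monomial under
  \<open>D\<close> becomes a function update.\<close>

definition mon :: "(3 \<Rightarrow> nat) \<Rightarrow> (3 \<Rightarrow> nat) \<Rightarrow> nat \<Rightarrow> monomial" where
  "mon \<xi> \<eta> l = (\<Sum>i\<in>UNIV. Poly_Mapping.single (Vx i) (\<xi> i))
     + (\<Sum>i\<in>UNIV. Poly_Mapping.single (Vy i) (\<eta> i)) + Poly_Mapping.single Vv l"

lemma lookup_mon [simp]:
  "Poly_Mapping.lookup (mon \<xi> \<eta> l) (Vx i) = \<xi> i"
  "Poly_Mapping.lookup (mon \<xi> \<eta> l) (Vy i) = \<eta> i"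
  "Poly_Mapping.lookup (mon \<xi> \<eta> l) Vv = l"
  by (simp_all add: mon_def lookup_add lookup_sum lookup_single when_def)

lemma monomial_eqI:
  fixes m n :: monomial
  assumes "\<And>i. Poly_Mapping.lookup m (Vx i) = Poly_Mapping.lookup n (Vx i)"
    and "\<And>i. Poly_Mapping.lookup m (Vy i) = Poly_Mapping.lookup n (Vy i)"
    and "Poly_Mapping.lookup m Vv = Poly_Mapping.lookup n Vv"
  shows "m = n"
proof (rule poly_mapping_eqI)
  fix u show "Poly_Mapping.lookup m u = Poly_Mapping.lookup n u"
    by (cases u) (simp_all add: assms)
qed

lemma lookup_deriv_D_x_term:
  "Poly_Mapping.lookup (var_x k ^ a * partial_deriv (Vy k) f) (mon \<xi> \<eta> l) =
     (if a \<le> \<xi> k then of_nat (Suc (\<eta> k)) *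
        Poly_Mapping.lookup f (mon (\<xi>(k := \<xi> k - a)) (\<eta>(k := Suc (\<eta> k))) l) else 0)"
proof (cases "a \<le> \<xi> k")
  case True
  have "mon \<xi> \<eta> l = Poly_Mapping.single (Vx k) a + mon (\<xi>(k := \<xi> k - a)) \<eta> l"
    using True by (intro monomial_eqI) (auto simp: lookup_add lookup_single when_def)
  moreover have "mon (\<xi>(k := \<xi> k - a)) \<eta> l + Poly_Mapping.single (Vy k) 1
      = mon (\<xi>(k := \<xi> k - a)) (\<eta>(k := Suc (\<eta> k))) l"
    by (intro monomial_eqI) (auto simp: lookup_add lookup_single when_def)
  ultimately show ?thesis
    using True by (simp add: indet_power lookup_single_mult_add lookup_partial_deriv)
next
  case False
  then show ?thesis
    unfolding indet_power by (subst lookup_single_mult_eq_0[where u = "Vx k"]) (auto simp: lookup_single)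
qed

lemma lookup_deriv_D_v_term:
  "Poly_Mapping.lookup ((var_y 1 * var_y 2 * var_y 3) ^ b * partial_deriv Vv f) (mon \<xi> \<eta> l) =
     (if \<forall>k. b \<le> \<eta> k then of_nat (Suc l) *
        Poly_Mapping.lookup f (mon \<xi> (\<lambda>k. \<eta> k - b) (Suc l)) else 0)"
proof -
  define B where "B = mon (\<lambda>_. 0) (\<lambda>_. b) 0"
  have B: "(var_y 1 * var_y 2 * var_y 3) ^ b = (Poly_Mapping.single B 1 :: 'a poly7)"
    by (simp add: power_mult_distrib indet_power mult_single B_def mon_def sum_UNIV_3)
  show ?thesis
  proof (cases "\<forall>k. b \<le> \<eta> k")
    case True
    have "mon \<xi> \<eta> l = B + mon \<xi> (\<lambda>k. \<eta> k - b) l"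
      unfolding B_def using True by (intro monomial_eqI) (auto simp: lookup_add)
    moreover have "mon \<xi> (\<lambda>k. \<eta> k - b) l + Poly_Mapping.single Vv 1 = mon \<xi> (\<lambda>k. \<eta> k - b) (Suc l)"
      by (intro monomial_eqI) (auto simp: lookup_add lookup_single when_def)
    ultimately show ?thesis
      using True by (simp add: B lookup_single_mult_add lookup_partial_deriv)
  next
    case False
    then obtain k where "\<eta> k < b" by (auto simp: not_le)
    then show ?thesis
      unfolding B using False
      by (subst lookup_single_mult_eq_0[where u = "Vy k"]) (auto simp: B_def)
  qed
qed

text \<open>For a kernel element the left side is zero, and this becomes a recursion: coefficients
  of \<open>v\<close>-degree \<open>Suc l\<close> are governed by those of \<open>v\<close>-degree
  \<open>l\<close>.\<close>

lemma lookup_deriv_D: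
  "Poly_Mapping.lookup (deriv_D a b f) (mon \<xi> \<eta> l) =
     (\<Sum>k\<in>UNIV. if a \<le> \<xi> k then of_nat (Suc (\<eta> k)) *
        Poly_Mapping.lookup f (mon (\<xi>(k := \<xi> k - a)) (\<eta>(k := Suc (\<eta> k))) l) else 0)
     + (if \<forall>k. b \<le> \<eta> k then of_nat (Suc l) *
        Poly_Mapping.lookup f (mon \<xi> (\<lambda>k. \<eta> k - b) (Suc l)) else 0)"
  unfolding deriv_D_def lookup_add lookup_deriv_D_x_term lookup_deriv_D_v_term sum_UNIV_3 ..

lemma scaled_monomial_update:
  assumes "a \<le> a * i j"
  shows "(\<lambda>k. a * i k)(j := a * i j - a) = (\<lambda>k. (a :: nat) * (i(j := i j - 1)) k)"
  using assms by (auto simp: right_diff_distrib')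

text \<open>The \<open>j\<close>-th summand comes from the monomial with \<open>i j\<close> lowered
  and \<open>\<eta> j\<close> raised by one. This preserves \<open>\<eta> k + i k\<close> and drops
  the total of \<open>i\<close> to \<open>l\<close>, where \<open>sign\<close> applies; the
  multiplier \<open>Suc (\<eta> j)\<close> is positive, so no sign is introduced.\<close>

lemma deriv_D_x_coeff_sign:
  fixes f :: "'k::field_char_0 poly7" and i \<eta> \<alpha> :: "3 \<Rightarrow> nat"
  assumes a: "a \<ge> 1"
    and sign: "\<And>i \<eta>. (\<Sum>k\<in>UNIV. i k) = l \<Longrightarrow> \<forall>k. \<eta> k + i k + b * l = \<alpha> k \<Longrightarrow>
      \<exists>n :: nat. fact l * Poly_Mapping.lookup f (mon (\<lambda>k. a * i k) \<eta> l) = (- 1) ^ l * of_nat n * c"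
    and i: "(\<Sum>k\<in>UNIV. i k) = Suc l" and \<eta>: "\<forall>k. \<eta> k + i k + b * l = \<alpha> k"
  shows "\<exists>n :: nat. fact l * (if a \<le> a * i j then of_nat (Suc (\<eta> j)) *
      Poly_Mapping.lookup f (mon ((\<lambda>k. a * i k)(j := a * i j - a)) (\<eta>(j := Suc (\<eta> j))) l) else 0)
    = (- 1) ^ l * of_nat n * c"
proof (cases "a \<le> a * i j")
  case True
  then have ij: "i j \<ge> 1" using a by (cases "i j") auto
  define i' where "i' = i(j := i j - 1)"
  have "(\<Sum>k\<in>UNIV. i k) = (\<Sum>k\<in>UNIV. i' k + (if k = j then 1 else 0))"
    using ij by (intro sum.cong) (auto simp: i'_def)
  also have "\<dots> = (\<Sum>k\<in>UNIV. i' k) + 1" by (simp add: sum.distrib)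
  finally have "(\<Sum>k\<in>UNIV. i' k) = l" using i by simp
  moreover have "\<forall>k. (\<eta>(j := Suc (\<eta> j))) k + i' k + b * l = \<alpha> k"
    using \<eta> ij by (auto simp: i'_def)
  ultimately obtain n :: nat where
    n: "fact l * Poly_Mapping.lookup f (mon (\<lambda>k. a * i' k) (\<eta>(j := Suc (\<eta> j))) l) = (- 1) ^ l * of_nat n * c"
    using sign by blast
  have "fact l * (of_nat (Suc (\<eta> j)) *
      Poly_Mapping.lookup f (mon (\<lambda>k. a * i' k) (\<eta>(j := Suc (\<eta> j))) l))
    = (- 1) ^ l * of_nat (Suc (\<eta> j) * n) * c"
    unfolding mult.left_commute[of "fact l"] n of_nat_mult by (simp only: mult_ac)
  then show ?thesis
    unfolding if_P[OF True] scaled_monomial_update[of a i j, OF True] i'_def[symmetric] by blast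
next
  case False
  \<comment> \<open>Here \<open>i j = 0\<close>: the summand is absent and counts as the multiple
    zero.\<close>
  then show ?thesis by (auto intro!: exI[of _ 0])
qed

text \<open>Assuming \<open>sign\<close> at a single level \<open>l\<close> lets this serve twice:
  within the induction that proves the sign claim, and afterwards in propagating nonzero
  coefficients. For the latter the individual \<open>n j\<close> are exposed as well as their
  sum.\<close>

lemma deriv_D_x_coeffs_sign:
  fixes f :: "'k::field_char_0 poly7" and i \<eta> \<alpha> :: "3 \<Rightarrow> nat"
  assumes a: "a \<ge> 1"
    and sign: "\<And>i \<eta>. (\<Sum>k\<in>UNIV. i k) = l \<Longrightarrow> \<forall>k. \<eta> k + i k + b * l = \<alpha> k \<Longrightarrow>
      \<exists>n :: nat. fact l * Poly_Mapping.lookup f (mon (\<lambda>k. a * i k) \<eta> l) = (- 1) ^ l * of_nat n * c"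
    and i: "(\<Sum>k\<in>UNIV. i k) = Suc l" and \<eta>: "\<forall>k. \<eta> k + i k + b * l = \<alpha> k"
  defines "t j \<equiv> if a \<le> a * i j then of_nat (Suc (\<eta> j)) *
      Poly_Mapping.lookup f (mon ((\<lambda>k. a * i k)(j := a * i j - a)) (\<eta>(j := Suc (\<eta> j))) l) else 0"
  obtains n :: "3 \<Rightarrow> nat" where "\<And>j. fact l * t j = (- 1) ^ l * of_nat (n j) * c"
    and "fact l * (\<Sum>j\<in>UNIV. t j) = (- 1) ^ l * of_nat (\<Sum>j\<in>UNIV. n j) * c"
proof -
  have "\<exists>n :: nat. fact l * t j = (- 1) ^ l * of_nat n * c" for j
    unfolding t_def by (rule deriv_D_x_coeff_sign[OF a sign i \<eta>])
  then obtain n :: "3 \<Rightarrow> nat" where n: "\<And>j. fact l * t j = (- 1) ^ l * of_nat (n j) * c"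
    by metis
  have "fact l * (\<Sum>j\<in>UNIV. t j) = (- 1) ^ l * of_nat (\<Sum>j\<in>UNIV. n j) * c"
    by (simp add: sum_distrib_left sum_distrib_right n)
  with n show thesis by (rule that)
qed

text \<open>A kernel element is determined by its terms \<open>c y\<^sup>\<alpha>\<close>: those force the terms
  \<open>x\<^bsup>ai\<^esup> y\<^bsup>\<alpha> - i - bl\<^esup> v\<^sup>l\<close> with \<open>\<bar>i\<bar> = l\<close>, whose coefficients are \<open>(- 1)\<^sup>l\<close> times
  nonnegative rational multiples of \<open>c\<close>, so that no cancellation occurs.\<close>

lemma kernel_D_coeff_sign:
  fixes f :: "'k::field_char_0 poly7" and i \<eta> \<alpha> :: "3 \<Rightarrow> nat"
  assumes a: "a \<ge> 1" and f: "f \<in> kernel_D a b"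
    and "(\<Sum>k\<in>UNIV. i k) = l" and "\<forall>k. \<eta> k + i k + b * l = \<alpha> k"
  shows "\<exists>n :: nat. fact l * Poly_Mapping.lookup f (mon (\<lambda>k. a * i k) \<eta> l)
    = (- 1) ^ l * of_nat n * Poly_Mapping.lookup f (mon (\<lambda>_. 0) \<alpha> 0)"
  using assms(3,4)
proof (induction l arbitrary: i \<eta>)
  case 0
  then have "i = (\<lambda>_. 0)" "\<eta> = \<alpha>" by auto
  then show ?case by (auto intro!: exI[of _ 1])
next
  case (Suc l)
  let ?c = "Poly_Mapping.lookup f (mon (\<lambda>_. 0) \<alpha> 0)"
  \<comment> \<open>At \<open>y\<close>-exponents raised by \<open>b\<close>, the \<open>v\<close>
    summand of \<open>D f\<close> reads off exactly the coefficient at \<open>\<eta>\<close> and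
    \<open>Suc l\<close>, and its guard holds automatically.\<close>
  define \<eta>' where "\<eta>' k = \<eta> k + b" for k
  have \<eta>': "\<forall>k. \<eta>' k + i k + b * l = \<alpha> k" using Suc.prems(2) by (simp add: \<eta>'_def ac_simps)
  define t where "t j = (if a \<le> a * i j then of_nat (Suc (\<eta>' j)) *
      Poly_Mapping.lookup f (mon ((\<lambda>k. a * i k)(j := a * i j - a)) (\<eta>'(j := Suc (\<eta>' j))) l) else 0)" for j
  obtain n :: "3 \<Rightarrow> nat" where n: "fact l * (\<Sum>j\<in>UNIV. t j) = (- 1) ^ l * of_nat (\<Sum>j\<in>UNIV. n j) * ?c"
    unfolding t_def using deriv_D_x_coeffs_sign[OF a Suc.IH Suc.prems(1) \<eta>'] by metis
  have "Poly_Mapping.lookup (deriv_D a b f) (mon (\<lambda>k. a * i k) \<eta>' l) = 0"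
    using f by (simp add: kernel_D_def)
  then have "(\<Sum>j\<in>UNIV. t j) + of_nat (Suc l) * Poly_Mapping.lookup f (mon (\<lambda>k. a * i k) \<eta> (Suc l)) = 0"
    unfolding lookup_deriv_D t_def by (simp add: \<eta>'_def)
  then have "of_nat (Suc l) * Poly_Mapping.lookup f (mon (\<lambda>k. a * i k) \<eta> (Suc l)) = - (\<Sum>j\<in>UNIV. t j)"
    by (simp add: eq_neg_iff_add_eq_0 add.commute)
  \<comment> \<open>The factorial absorbs the division by \<open>Suc l\<close> in solving the
    recursion; the minus sign supplies the next power of \<open>- 1\<close>.\<close>
  then have "fact (Suc l) * Poly_Mapping.lookup f (mon (\<lambda>k. a * i k) \<eta> (Suc l))
      = - (fact l * (\<Sum>j\<in>UNIV. t j))"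
    unfolding fact_Suc by (metis mult.assoc mult.commute mult_minus_right)
  also have "\<dots> = (- 1) ^ Suc l * of_nat (\<Sum>j\<in>UNIV. n j) * ?c" unfolding n by simp
  finally show ?case by blast
qed

text \<open>Consider the coefficient of \<open>D f\<close> at the monomial obtained by trading one
  \<open>y_j\<close> for \<open>x_j^a\<close>. The given nonzero coefficient contributes there, and
  the other \<open>x\<close> summands are multiples of \<open>c\<close> with the same sign, so their
  sum is nonzero. Since \<open>D f = 0\<close>, the \<open>v\<close> summand must be present and
  nonzero, which are the two conclusions.\<close>

lemma kernel_D_coeff_step:
  fixes f :: "'k::field_char_0 poly7" and i \<eta> \<alpha> :: "3 \<Rightarrow> nat"
  assumes a: "a \<ge> 1" and f: "f \<in> kernel_D a b"
    and i: "(\<Sum>k\<in>UNIV. i k) = l" and \<eta>: "\<forall>k. \<eta> k + i k + b * l = \<alpha> k"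
    and c: "Poly_Mapping.lookup f (mon (\<lambda>_. 0) \<alpha> 0) \<noteq> 0"
    and nz: "Poly_Mapping.lookup f (mon (\<lambda>k. a * i k) \<eta> l) \<noteq> 0" and pos: "\<eta> j > 0"
  shows "\<forall>k. b \<le> (\<eta>(j := \<eta> j - 1)) k" (is ?A)
    and "Poly_Mapping.lookup f
      (mon (\<lambda>k. a * (i(j := Suc (i j))) k) (\<lambda>k. (\<eta>(j := \<eta> j - 1)) k - b) (Suc l)) \<noteq> 0" (is ?B)
proof -
  define i' where "i' = i(j := Suc (i j))"
  define \<eta>' where "\<eta>' = \<eta>(j := \<eta> j - 1)"
  define t where "t k = (if a \<le> a * i' k then of_nat (Suc (\<eta>' k)) *
      Poly_Mapping.lookup f (mon ((\<lambda>k. a * i' k)(k := a * i' k - a)) (\<eta>'(k := Suc (\<eta>' k))) l) else 0)" for k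
  have "(\<Sum>k\<in>UNIV. i' k) = (\<Sum>k\<in>UNIV. i k + (if k = j then 1 else 0))"
    by (intro sum.cong) (auto simp: i'_def)
  also have "\<dots> = (\<Sum>k\<in>UNIV. i k) + 1" by (simp add: sum.distrib)
  finally have i'_sum: "(\<Sum>k\<in>UNIV. i' k) = Suc l" using i by simp
  have \<eta>'_sum: "\<forall>k. \<eta>' k + i' k + b * l = \<alpha> k"
  proof
    fix k show "\<eta>' k + i' k + b * l = \<alpha> k"
      using \<eta>[rule_format, of k] pos by (auto simp: i'_def \<eta>'_def)
  qed
  obtain n :: "3 \<Rightarrow> nat"
    where n: "\<And>k. fact l * t k = (- 1) ^ l * of_nat (n k) * Poly_Mapping.lookup f (mon (\<lambda>_. 0) \<alpha> 0)"
    and n_sum: "fact l * (\<Sum>k\<in>UNIV. t k)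
      = (- 1) ^ l * of_nat (\<Sum>k\<in>UNIV. n k) * Poly_Mapping.lookup f (mon (\<lambda>_. 0) \<alpha> 0)"
    unfolding t_def
    using deriv_D_x_coeffs_sign[OF a kernel_D_coeff_sign[OF a f] i'_sum \<eta>'_sum] by blast
  \<comment> \<open>The \<open>j\<close>-th summand leads back to the monomial assumed to have a
    nonzero coefficient.\<close>
  have "(\<lambda>k. a * i' k)(j := a * i' j - a) = (\<lambda>k. a * i k)" "\<eta>'(j := Suc (\<eta>' j)) = \<eta>"
    using pos by (auto simp: i'_def \<eta>'_def)
  then have "t j \<noteq> 0" using nz by (auto simp: t_def i'_def simp flip: of_nat_Suc)
  then have "n j \<noteq> 0" using n[of j] by (metis fact_nonzero mult_eq_0_iff of_nat_0)
  then have "(\<Sum>k\<in>UNIV. n k) \<noteq> 0" by auto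
  \<comment> \<open>Characteristic zero keeps the positive sum nonzero in \<open>'k\<close>.\<close>
  then have "of_nat (\<Sum>k\<in>UNIV. n k) \<noteq> (0 :: 'k)" by (simp only: of_nat_eq_0_iff not_False_eq_True)
  then have "(\<Sum>k\<in>UNIV. t k) \<noteq> 0" using n_sum c by auto
  moreover have "(\<Sum>k\<in>UNIV. t k) + (if \<forall>k. b \<le> \<eta>' k then of_nat (Suc l) *
        Poly_Mapping.lookup f (mon (\<lambda>k. a * i' k) (\<lambda>k. \<eta>' k - b) (Suc l)) else 0) = 0"
    using f lookup_deriv_D[of a b f "\<lambda>k. a * i' k" \<eta>' l] by (simp add: kernel_D_def t_def)
  ultimately show ?A ?B
    unfolding i'_def[symmetric] \<eta>'_def[symmetric] by (auto split: if_splits)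
qed

text \<open>Iterating the previous step would produce nonzero coefficients in every
  \<open>v\<close>-degree \<open>l\<close>, whereas
  \<open>\<eta> k + i k + b * l = \<alpha> k\<close> with \<open>b \<ge> 1\<close> bounds
  \<open>l\<close>. The induction carries along a positive \<open>y\<close>-exponent so that the
  step stays applicable.\<close>

lemma kernel_D_coeff_y_eq_0:
  fixes f :: "'k::field_char_0 poly7" and \<alpha> :: "3 \<Rightarrow> nat"
  assumes a: "a \<ge> 1" and b: "b \<ge> 1" and f: "f \<in> kernel_D a b" and \<alpha>: "\<alpha> j > 0"
  shows "Poly_Mapping.lookup f (mon (\<lambda>_. 0) \<alpha> 0) = 0"
proof (rule ccontr)
  assume c: "Poly_Mapping.lookup f (mon (\<lambda>_. 0) \<alpha> 0) \<noteq> 0"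
  have "\<exists>i \<eta>. (\<Sum>k\<in>UNIV. i k) = l \<and> (\<forall>k. \<eta> k + i k + b * l = \<alpha> k)
      \<and> Poly_Mapping.lookup f (mon (\<lambda>k. a * i k) \<eta> l) \<noteq> 0 \<and> (\<exists>k. \<eta> k > 0)" for l
  proof (induction l)
    case 0
    show ?case using c \<alpha> by (intro exI[of _ "\<lambda>_. 0"] exI[of _ \<alpha>]) auto
  next
    case (Suc l)
    then obtain i \<eta> k where i: "(\<Sum>k\<in>UNIV. i k) = l" and \<eta>: "\<forall>k. \<eta> k + i k + b * l = \<alpha> k"
      and nz: "Poly_Mapping.lookup f (mon (\<lambda>k. a * i k) \<eta> l) \<noteq> 0" and k: "\<eta> k > 0"
      by blast
    note step = kernel_D_coeff_step[OF a f i \<eta> c nz]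
    \<comment> \<open>One positive exponent suffices: after lowering it, all exponents are still at
      least \<open>b \<ge> 1\<close>.\<close>
    have pos: "\<eta> j > 0" for j
      using step(1)[OF k, rule_format, of j] b k by (auto split: if_splits)
    \<comment> \<open>Taking the step in direction \<open>j\<close> itself gives
      \<open>\<eta> j - 1 \<ge> b\<close>.\<close>
    have large: "\<eta> j \<ge> Suc b" for j
      using step(1)[OF pos[of j], rule_format, of j] pos[of j] by auto
    define i' where "i' = i(1 := Suc (i 1))"
    define \<eta>' where "\<eta>' k = (\<eta>(1 := \<eta> 1 - 1)) k - b" for k
    have "(\<Sum>k\<in>UNIV. i' k) = Suc l" using i by (simp add: i'_def sum_UNIV_3)
    moreover have "\<forall>k. \<eta>' k + i' k + b * Suc l = \<alpha> k"
    proof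
      fix k show "\<eta>' k + i' k + b * Suc l = \<alpha> k"
        using \<eta>[rule_format, of k] large[of k] by (auto simp: \<eta>'_def i'_def)
    qed
    moreover have "Poly_Mapping.lookup f (mon (\<lambda>k. a * i' k) \<eta>' (Suc l)) \<noteq> 0"
      using step(2)[OF pos[of 1]] by (simp add: i'_def \<eta>'_def[abs_def])
    \<comment> \<open>Only \<open>y_1\<close> was traded, so the exponent of \<open>y_2\<close>
      loses just \<open>b\<close> and remains positive.\<close>
    moreover have "\<eta>' 2 > 0" using large[of 2] by (simp add: \<eta>'_def)
    ultimately show ?case by blast
  qed
  \<comment> \<open>At this level \<open>b * l\<close> already exceeds
    \<open>\<alpha> 1\<close>.\<close>
  from this[of "Suc (\<alpha> 1)"] obtain i \<eta> where "\<forall>k. \<eta> k + i k + b * Suc (\<alpha> 1) = \<alpha> k" by blast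
  then have "\<eta> 1 + i 1 + b * Suc (\<alpha> 1) = \<alpha> 1" ..
  moreover have "Suc (\<alpha> 1) \<le> b * Suc (\<alpha> 1)" using b by (cases b) auto
  ultimately show False by linarith
qed

lemma kernel_D_coeff_eq_0:
  fixes f :: "'k::field_char_0 poly7"
  assumes a: "a \<ge> 1" and b: "b \<ge> 1" and f: "f \<in> kernel_D a b"
    and m: "\<And>i. Poly_Mapping.lookup m (Vx i) = 0" "m \<noteq> 0"
  shows "Poly_Mapping.lookup f m = 0"
proof -
  define \<eta> where "\<eta> i = Poly_Mapping.lookup m (Vy i)" for i
  define l where "l = Poly_Mapping.lookup m Vv"
  have meq: "m = mon (\<lambda>_. 0) \<eta> l" by (rule monomial_eqI) (simp_all add: m \<eta>_def l_def)
  show ?thesis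
  proof (cases l)
    case 0
    have "\<exists>j. \<eta> j > 0"
    proof (rule ccontr)
      assume "\<not> ?thesis"
      then have "m = 0" unfolding meq 0 by (intro monomial_eqI) auto
      with m(2) show False by simp
    qed
    then show ?thesis using kernel_D_coeff_y_eq_0[OF a b f] unfolding meq 0 by blast
  next
    case (Suc l')
    \<comment> \<open>When \<open>v\<close> occurs, look at the monomial of \<open>D f\<close>
      coming from the \<open>v\<close> summand: it is free of \<open>x\<close>, so with
      \<open>a \<ge> 1\<close> the \<open>x\<close> summands cannot reach it, and the coefficient
      stands alone.\<close>
    have "Poly_Mapping.lookup (deriv_D a b f) (mon (\<lambda>_. 0) (\<lambda>k. \<eta> k + b) l') = 0"
      using f by (simp add: kernel_D_def)
    then have "of_nat (Suc l') * Poly_Mapping.lookup f (mon (\<lambda>_. 0) \<eta> (Suc l')) = 0"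
      using a unfolding lookup_deriv_D by simp
    then show ?thesis unfolding meq Suc mult_eq_0_iff of_nat_eq_0_iff by simp
  qed
qed

lemma kernel_D_eval_at_const:
  fixes f :: "'k::field_char_0 poly7"
  assumes "a \<ge> 1" and "b \<ge> 1" and "f \<in> kernel_D a b" and p: "\<And>i. p (Vx i) = 0"
  shows "eval_at f p = Poly_Mapping.lookup f 0"
proof -
  have "Poly_Mapping.lookup f m * (\<Prod>u\<in>Poly_Mapping.keys m. p u ^ Poly_Mapping.lookup m u)
      = (if m = 0 then Poly_Mapping.lookup f 0 else 0)" for m
  proof (cases "m \<noteq> 0 \<and> (\<exists>i. Poly_Mapping.lookup m (Vx i) \<noteq> 0)")
    case True
    then obtain i where "Vx i \<in> Poly_Mapping.keys m" "p (Vx i) ^ Poly_Mapping.lookup m (Vx i) = 0"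
      using p by (auto simp: in_keys_iff power_0_left)
    then have "(\<Prod>u\<in>Poly_Mapping.keys m. p u ^ Poly_Mapping.lookup m u) = 0"
      by (meson finite_keys prod_zero)
    with True show ?thesis by simp
  next
    case False
    then show ?thesis using kernel_D_coeff_eq_0[OF assms(1-3), of m] by auto
  qed
  then have "eval_at f p = (\<Sum>m\<in>Poly_Mapping.keys f. if m = 0 then Poly_Mapping.lookup f 0 else 0)"
    unfolding eval_at_def by (intro sum.cong) auto
  also have "\<dots> = Poly_Mapping.lookup f 0" by (auto simp: sum.delta' in_keys_iff)
  finally show ?thesis .
qed

section \<open>The algebra A and its localizations\<close>

lemma scalar_mult: "scalar (c * d) = scalar c * scalar d"
  by (simp add: scalar_def mult_single)

lemma scalar_0 [simp]: "scalar 0 = 0"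
  and scalar_1 [simp]: "scalar 1 = 1"
  and scalar_minus_1: "scalar (- 1) = - 1"
  and scalar_of_nat: "scalar (of_nat n) = of_nat n"
  by (simp_all add: scalar_def single_uminus)

lemma subalgebraD:
  assumes "subalgebra A"
  shows "scalar c \<in> A" "f \<in> A \<Longrightarrow> g \<in> A \<Longrightarrow> f + g \<in> A" "f \<in> A \<Longrightarrow> g \<in> A \<Longrightarrow> f * g \<in> A"
  using assms by (auto simp: subalgebra_def)

lemma subalgebra_0: "subalgebra A \<Longrightarrow> 0 \<in> A"
  using subalgebraD(1)[of A 0] by simp

lemma subalgebra_1: "subalgebra A \<Longrightarrow> 1 \<in> A"
  using subalgebraD(1)[of A 1] by simp

lemma subalgebra_of_nat: "subalgebra A \<Longrightarrow> of_nat n \<in> A"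
  using subalgebraD(1)[of A "of_nat n"] by (simp add: scalar_of_nat)

lemma subalgebra_uminus: "subalgebra A \<Longrightarrow> f \<in> A \<Longrightarrow> - f \<in> A"
  using subalgebraD(3)[of A "scalar (- 1)" f] subalgebraD(1)[of A "- 1"]
  by (simp add: scalar_minus_1)

lemma subalgebra_diff: "subalgebra A \<Longrightarrow> f \<in> A \<Longrightarrow> g \<in> A \<Longrightarrow> f - g \<in> A"
  using subalgebraD(2)[of A f "- g"] subalgebra_uminus[of A g] by simp

lemma subalgebra_power: "subalgebra A \<Longrightarrow> f \<in> A \<Longrightarrow> f ^ n \<in> A"
  by (induction n) (auto intro: subalgebraD subalgebra_1)

lemma subalgebra_sum: "subalgebra A \<Longrightarrow> (\<And>i. i \<in> I \<Longrightarrow> f i \<in> A) \<Longrightarrow> (\<Sum>i\<in>I. f i) \<in> A"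
  by (induction I rule: infinite_finite_induct) (auto intro: subalgebraD subalgebra_0)

lemma subalgebra_hull: "subalgebra (subalgebra hull S)"
  by (rule hull_in) (auto simp: subalgebra_def)

lemma subalgebra_eq_UNIV:
  assumes A: "subalgebra A" and indet: "\<And>u. indet u \<in> A"
  shows "A = (UNIV :: 'k::comm_ring_1 poly7 set)"
proof -
  have "Poly_Mapping.single m c \<in> A" for m and c :: 'k
  proof (induction "\<Sum>u\<in>Poly_Mapping.keys m. Poly_Mapping.lookup m u" arbitrary: m rule: less_induct)
    case less
    show ?case
    proof (cases "m = 0")
      case True
      then show ?thesis using subalgebraD(1)[OF A, of c] by (simp add: scalar_def)
    next
      case False
      then obtain u where u: "u \<in> Poly_Mapping.keys m" by fastforce
      define m' where "m' = m - Poly_Mapping.single u 1"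
      have m: "m = Poly_Mapping.single u 1 + m'"
        using u unfolding m'_def
        by (intro poly_mapping_eqI) (auto simp: lookup_add lookup_minus lookup_single when_def in_keys_iff)
      have "(\<Sum>w\<in>Poly_Mapping.keys m'. Poly_Mapping.lookup m' w)
          = (\<Sum>w\<in>Poly_Mapping.keys m. Poly_Mapping.lookup m' w)"
      proof (rule sum.mono_neutral_left)
        show "Poly_Mapping.keys m' \<subseteq> Poly_Mapping.keys m"
          by (auto simp: m lookup_add in_keys_iff)
      qed (auto simp: in_keys_iff)
      also have "\<dots> < (\<Sum>w\<in>Poly_Mapping.keys m. Poly_Mapping.lookup m w)"
      proof (rule sum_strict_mono_ex1)
        have "Poly_Mapping.lookup m' u < Poly_Mapping.lookup m u" by (simp add: m lookup_add)
        then show "\<exists>w\<in>Poly_Mapping.keys m. Poly_Mapping.lookup m' w < Poly_Mapping.lookup m w"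
          using u by blast
      qed (auto simp: m lookup_add)
      finally have "Poly_Mapping.single m' c \<in> A" by (rule less)
      then have "indet u * Poly_Mapping.single m' c \<in> A" by (intro subalgebraD A indet)
      also have "indet u * Poly_Mapping.single m' c = Poly_Mapping.single m c"
        unfolding indet_def mult_single m[symmetric] by simp
      finally show ?thesis .
    qed
  qed
  then have "f \<in> A" for f
    by (induction f rule: poly7_induct) (auto intro: subalgebraD A subalgebra_0)
  then show ?thesis by blast
qed

lemma subalgebra_kernel_D: "subalgebra (kernel_D a b)"
  by (auto simp: subalgebra_def kernel_D_def deriv_D_add deriv_D_mult)

text \<open>The set is the ring \<open>A[y]\<close>.\<close>

lemma subalgebra_adjoin:
  assumes A: "subalgebra A"
  shows "subalgebra {poly p y | p. \<forall>n. coeff p n \<in> A}"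
  unfolding subalgebra_def
proof (intro conjI allI ballI)
  fix c
  have "scalar c = poly [:scalar c:] y" by simp
  moreover have "\<forall>n. coeff [:scalar c:] n \<in> A"
    using A by (auto simp: coeff_pCons split: nat.split intro: subalgebraD subalgebra_0)
  ultimately show "scalar c \<in> {poly p y | p. \<forall>n. coeff p n \<in> A}" by blast
next
  fix f g assume "f \<in> {poly p y | p. \<forall>n. coeff p n \<in> A}" "g \<in> {poly p y | p. \<forall>n. coeff p n \<in> A}"
  then obtain p q where p: "f = poly p y" "\<forall>n. coeff p n \<in> A" and q: "g = poly q y" "\<forall>n. coeff q n \<in> A"
    by blast
  have "f + g = poly (p + q) y" "\<forall>n. coeff (p + q) n \<in> A"
    using p q A by (auto intro: subalgebraD)
  then show "f + g \<in> {poly p y | p. \<forall>n. coeff p n \<in> A}" by blast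
  have "f * g = poly (p * q) y" "\<forall>n. coeff (p * q) n \<in> A"
    using p q A by (auto simp: coeff_mult intro!: subalgebraD subalgebra_sum)
  then show "f * g \<in> {poly p y | p. \<forall>n. coeff p n \<in> A}" by blast
qed

text \<open>For nonzero \<open>x\<close> the set consists of the polynomials lying in
  \<open>R[1/x]\<close>, described without fractions.\<close>

lemma subalgebra_localization:
  assumes R: "subalgebra R" and x: "x \<in> R"
  shows "subalgebra {f. \<exists>M :: nat. x ^ M * f \<in> R}"
  unfolding subalgebra_def
proof (intro conjI allI ballI)
  fix c
  have "x ^ 0 * scalar c \<in> R" using subalgebraD(1)[OF R] by simp
  then show "scalar c \<in> {f. \<exists>M :: nat. x ^ M * f \<in> R}" by blast
next
  fix f g assume "f \<in> {f. \<exists>M :: nat. x ^ M * f \<in> R}" "g \<in> {f. \<exists>M :: nat. x ^ M * f \<in> R}"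
  then obtain M N where M: "x ^ M * f \<in> R" and N: "x ^ N * g \<in> R" by blast
  have "x ^ (M + N) * (f + g) = x ^ N * (x ^ M * f) + x ^ M * (x ^ N * g)"
    by (simp add: power_add algebra_simps)
  also have "\<dots> \<in> R" by (intro subalgebraD R subalgebra_power x M N)
  finally show "f + g \<in> {f. \<exists>M :: nat. x ^ M * f \<in> R}" by blast
  have "x ^ (M + N) * (f * g) = (x ^ M * f) * (x ^ N * g)"
    by (simp add: power_add algebra_simps)
  also have "\<dots> \<in> R" by (intro subalgebraD R M N)
  finally show "f * g \<in> {f. \<exists>M :: nat. x ^ M * f \<in> R}" by blast
qed

section \<open>Polynomials in \<open>y_i\<close> over the kernel\<close>

lemma deriv_D_poly_y:
  assumes "\<forall>n. coeff p n \<in> kernel_D a b"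
  shows "deriv_D a b (poly p (var_y i)) = var_x i ^ a * poly (pderiv p) (var_y i :: 'k::field_char_0 poly7)"
  using assms
proof (induction p)
  case (pCons c p)
  have "deriv_D a b c = 0"
    using pCons.prems[rule_format, of 0] by (simp add: kernel_D_def)
  moreover have "\<forall>n. coeff p n \<in> kernel_D a b"
  proof
    fix n show "coeff p n \<in> kernel_D a b" using pCons.prems[rule_format, of "Suc n"] by simp
  qed
  then have "deriv_D a b (poly p (var_y i)) = var_x i ^ a * poly (pderiv p) (var_y i)"
    by (rule pCons.IH)
  ultimately show ?case
    by (simp add: deriv_D_add deriv_D_mult pderiv_pCons algebra_simps)
qed simp

lemma coeff_pderiv_kernel_D:
  fixes p :: "'k::field_char_0 poly7 poly"
  assumes "\<forall>n. coeff p n \<in> kernel_D a b"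
  shows "\<forall>n. coeff (pderiv p) n \<in> kernel_D a b"
proof
  fix n show "coeff (pderiv p) n \<in> kernel_D a b"
    unfolding coeff_pderiv using assms
    by (intro subalgebraD(3)[OF subalgebra_kernel_D] subalgebra_of_nat[OF subalgebra_kernel_D]) simp
qed

text \<open>On polynomials in \<open>y_i\<close> over the kernel, \<open>D\<close> acts as
  \<open>x_i^a\<close> times the formal derivative. Applying it to a relation and cancelling
  \<open>x_i^a\<close> yields a relation of smaller degree; by induction the derivative vanishes,
  and in characteristic zero \<open>p\<close> is constant.\<close>

lemma y_transcendental_over_kernel_D:
  fixes p :: "'k::field_char_0 poly7 poly"
  assumes "\<forall>n. coeff p n \<in> kernel_D a b" and "poly p (var_y i) = 0"
  shows "p = 0"
  using assms
proof (induction "degree p" arbitrary: p rule: less_induct)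
  case less
  have "var_x i ^ a * poly (pderiv p) (var_y i) = 0"
    using deriv_D_poly_y[OF less.prems(1), of i] less.prems(2) by simp
  then have zero: "poly (pderiv p) (var_y i) = 0" by simp
  have "pderiv p = 0"
  proof (cases "degree p = 0")
    case False
    then have "degree (pderiv p) < degree p" by (simp add: degree_pderiv)
    from less.hyps[OF this coeff_pderiv_kernel_D[OF less.prems(1)] zero] show ?thesis .
  qed (simp add: pderiv_eq_0_iff)
  then obtain c where "p = [:c:]" using pderiv_iszero by blast
  with less.prems(2) show ?case by simp
qed

text \<open>Here \<open>D\<close> of the value is zero, so \<open>y_i\<close> is a root of
  \<open>pderiv p\<close>; transcendence makes \<open>pderiv p\<close> zero and \<open>p\<close>
  constant.\<close>

lemma kernel_D_poly_y:
  fixes p :: "'k::field_char_0 poly7 poly"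
  assumes p: "\<forall>n. coeff p n \<in> kernel_D a b" and "poly p (var_y i) \<in> kernel_D a b"
  shows "poly p (var_y i) = coeff p 0"
proof -
  have "var_x i ^ a * poly (pderiv p) (var_y i) = 0"
    using assms(2) deriv_D_poly_y[OF p, of i] by (simp add: kernel_D_def)
  then have "poly (pderiv p) (var_y i) = 0" by simp
  then have "pderiv p = 0"
    by (rule y_transcendental_over_kernel_D[OF coeff_pderiv_kernel_D[OF p]])
  then obtain c where "p = [:c:]" using pderiv_iszero by blast
  then show ?thesis by simp
qed

section \<open>The elements \<open>h_i\<close> are kernel elements\<close>

lemma to_fract_power: "to_fract (f ^ n) = to_fract f ^ n"
  by (induction n) auto

lemma deriv_D_power: "deriv_D a b (f ^ Suc n) = of_nat (Suc n) * f ^ n * deriv_D a b f"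
  by (induction n) (simp_all add: deriv_D_mult algebra_simps)

text \<open>The degree-\<open>k\<close> term of \<open>theta a b var_v\<close> at
  \<open>T = - y_i / x_i^a\<close>, multiplied by \<open>x_i^(a * d)\<close> to clear denominators;
  this reading requires \<open>k \<le> d\<close>.\<close>

definition theta_term :: "nat \<Rightarrow> nat \<Rightarrow> 3 \<Rightarrow> nat \<Rightarrow> nat \<Rightarrow> 'k::field_char_0 poly7" where
  "theta_term a b i d k =
     scalar (1 / fact k) * (deriv_D a b ^^ k) var_v * (- var_y i) ^ k * var_x i ^ (a * (d - k))"

lemma mult_divide_cancel_middle: "W \<noteq> 0 \<Longrightarrow> (V * W) * (C * (Z / W)) = C * Z * (V :: 'a::field)"
  by simp

text \<open>With \<open>d\<close> the degree of \<open>theta a b var_v\<close>, clearing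
  denominators turns the defining fraction of \<open>h_i\<close> into an identity of polynomials, to
  which \<open>D\<close> can be applied. All higher iterates of \<open>D\<close> on \<open>v\<close>
  vanish.\<close>

lemma x_power_mult_h_poly:
  fixes a b :: nat and i :: 3
  obtains d where "(deriv_D a b ^^ Suc d) (var_v :: 'k::field_char_0 poly7) = 0"
    and "var_x i ^ (a * d) * (h_poly a b i :: 'k poly7) =
      var_x i ^ ((2 * b + 1) * a) * (\<Sum>k\<le>d. theta_term a b i d k)"
proof
  define \<Theta> where "\<Theta> = theta a b (var_v :: 'k poly7)"
  define d where "d = degree \<Theta>"
  define X where "X = (to_fract (var_x i) :: 'k poly7 fract)"
  define N where "N = (2 * b + 1) * a"
  have X0: "X \<noteq> 0" by (simp only: X_def to_fract_eq_0_iff indet_neq_0 not_False_eq_True)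
  have "scalar (1 / fact (Suc d)) * (deriv_D a b ^^ Suc d) (var_v :: 'k poly7) = 0"
    unfolding coeff_theta[symmetric] \<Theta>_def[symmetric] by (rule coeff_eq_0) (simp add: d_def)
  then have "scalar (fact (Suc d)) * (scalar (1 / fact (Suc d)) * (deriv_D a b ^^ Suc d) (var_v :: 'k poly7)) = 0"
    by (simp only: mult_zero_right)
  moreover have "scalar (fact (Suc d)) * scalar (1 / fact (Suc d)) = (1 :: 'k poly7)"
    unfolding scalar_mult[symmetric]
    by (simp only: times_divide_eq_right mult_1_right divide_self fact_nonzero not_False_eq_True scalar_1)
  ultimately show "(deriv_D a b ^^ Suc d) (var_v :: 'k poly7) = 0"
    unfolding mult.assoc[symmetric] by (simp only: mult_1_left)
  have deg: "degree (map_poly to_fract \<Theta>) = d" by (simp add: degree_map_poly d_def)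
  have "to_fract (var_x i ^ (a * d) * h_poly a b i)
    = X ^ (a * d) * (X ^ N * poly (map_poly to_fract \<Theta>) (- (to_fract (var_y i) / X ^ a)))"
    by (simp only: to_fract_mult to_fract_h_poly h_fract_def to_fract_power X_def N_def \<Theta>_def
        Fract_conv_to_fract)
  also have "\<dots> = X ^ N * (\<Sum>k\<le>d. X ^ (a * d) * (to_fract (coeff \<Theta> k) * (- (to_fract (var_y i) / X ^ a)) ^ k))"
    unfolding poly_altdef deg
    by (simp only: coeff_map_poly to_fract_0 sum_distrib_left mult.left_commute)
  also have "\<dots> = X ^ N * (\<Sum>k\<le>d. to_fract (theta_term a b i d k))"
  proof (intro arg_cong[of _ _ "\<lambda>s. X ^ N * s"] sum.cong)
    fix k assume "k \<in> {..d}"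
    then have "a * d = a * (d - k) + a * k" by (simp flip: distrib_left)
    then have "X ^ (a * d) = X ^ (a * (d - k)) * X ^ (a * k)" by (metis power_add)
    moreover have "(- (to_fract (var_y i) / X ^ a)) ^ k = to_fract ((- var_y i) ^ k) / X ^ (a * k)"
      by (simp only: minus_divide_left power_divide power_mult to_fract_power to_fract_uminus)
    ultimately have "X ^ (a * d) * (to_fract (coeff \<Theta> k) * (- (to_fract (var_y i) / X ^ a)) ^ k)
        = to_fract (coeff \<Theta> k) * to_fract ((- var_y i) ^ k) * X ^ (a * (d - k))"
      using mult_divide_cancel_middle[OF power_not_zero[OF X0]] by (simp only:)
    then show "X ^ (a * d) * (to_fract (coeff \<Theta> k) * (- (to_fract (var_y i) / X ^ a)) ^ k)
        = to_fract (theta_term a b i d k)"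
      by (simp only: theta_term_def \<Theta>_def coeff_theta to_fract_mult to_fract_power X_def)
  qed simp
  also have "\<dots> = to_fract (var_x i ^ N * (\<Sum>k\<le>d. theta_term a b i d k))"
    by (simp only: to_fract_mult to_fract_sum to_fract_power X_def)
  finally show "var_x i ^ (a * d) * (h_poly a b i :: 'k poly7) =
      var_x i ^ ((2 * b + 1) * a) * (\<Sum>k\<le>d. theta_term a b i d k)"
    by (simp only: to_fract_eq_iff N_def)
qed

text \<open>The quantity whose differences are the derivatives of the terms; the value zero at
  \<open>k = 0\<close> reflects that the power \<open>(- y_i)^0\<close> has derivative zero.\<close>

definition theta_boundary :: "nat \<Rightarrow> nat \<Rightarrow> 3 \<Rightarrow> nat \<Rightarrow> nat \<Rightarrow> 'k::field_char_0 poly7" where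
  "theta_boundary a b i d k = (case k of 0 \<Rightarrow> 0 | Suc k' \<Rightarrow>
     scalar (1 / fact k') * (deriv_D a b ^^ k) var_v * (- var_y i) ^ k' * var_x i ^ (a * (d - k')))"

text \<open>By the product rule, differentiating \<open>D^k v\<close> gives the boundary at
  \<open>Suc k\<close>. Differentiating \<open>(- y_i)^k\<close> gives a factor
  \<open>- k * x_i^a\<close>: the \<open>k\<close> reduces the factorial, and \<open>x_i^a\<close>
  restores the exponent belonging to \<open>k - 1\<close>.\<close>

lemma deriv_D_theta_term:
  assumes "k \<le> d"
  shows "deriv_D a b (theta_term a b i d k)
    = theta_boundary a b i d (Suc k) - (theta_boundary a b i d k :: 'k::field_char_0 poly7)"
proof -
  have D: "deriv_D a b (theta_term a b i d k) = theta_boundary a b i d (Suc k)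
      + scalar (1 / fact k) * (deriv_D a b ^^ k) var_v * deriv_D a b ((- var_y i) ^ k) * var_x i ^ (a * (d - k))"
    by (simp add: theta_term_def deriv_D_mult theta_boundary_def algebra_simps)
  show ?thesis
  proof (cases k)
    case 0
    then show ?thesis unfolding D by (simp add: theta_boundary_def)
  next
    case (Suc k')
    have c: "scalar (1 / fact k) * of_nat k = (scalar (1 / fact k') :: 'k poly7)"
      unfolding scalar_of_nat[symmetric] scalar_mult[symmetric] Suc
      by (simp del: of_nat_Suc)
    \<comment> \<open>The bound \<open>k \<le> d\<close> keeps this natural subtraction
      exact.\<close>
    have "a * (d - k') = a + a * (d - k)" using assms Suc by (simp add: Suc_diff_Suc flip: mult_Suc_right)
    then have x: "var_x i ^ (a * (d - k')) = (var_x i ^ a * var_x i ^ (a * (d - k)) :: 'k poly7)"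
      by (simp add: power_add)
    have "deriv_D a b ((- var_y i :: 'k poly7) ^ k) = of_nat k * (- var_y i) ^ k' * (- (var_x i ^ a))"
      unfolding Suc deriv_D_power by (simp add: deriv_D_minus)
    then have "scalar (1 / fact k) * (deriv_D a b ^^ k) var_v * deriv_D a b ((- var_y i) ^ k) * var_x i ^ (a * (d - k))
      = - ((scalar (1 / fact k) * of_nat k) * (deriv_D a b ^^ k) (var_v :: 'k poly7) * (- var_y i) ^ k'
          * (var_x i ^ a * var_x i ^ (a * (d - k))))"
      by (simp add: mult_ac)
    also have "\<dots> = - theta_boundary a b i d k" unfolding c x[symmetric] by (simp add: theta_boundary_def Suc)
    finally show ?thesis unfolding D by simp
  qed
qed

text \<open>The derivative of the cleared sum telescopes to the boundary at \<open>Suc d\<close>,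
  which contains the factor \<open>D^(d+1) v = 0\<close>; the power of \<open>x_i\<close> is then
  cancelled.\<close>

lemma h_poly_in_kernel_D: "(h_poly a b i :: 'k::field_char_0 poly7) \<in> kernel_D a b"
proof -
  obtain d where d: "(deriv_D a b ^^ Suc d) (var_v :: 'k poly7) = 0"
    and h: "var_x i ^ (a * d) * (h_poly a b i :: 'k poly7) =
      var_x i ^ ((2 * b + 1) * a) * (\<Sum>k\<le>d. theta_term a b i d k)"
    by (rule x_power_mult_h_poly)
  define e :: "nat \<Rightarrow> 'k poly7" where "e = theta_boundary a b i d"
  have "deriv_D a b (\<Sum>k\<le>d. theta_term a b i d k) = (\<Sum>k\<le>d. e (Suc k) - e k)"
    unfolding deriv_D_sum by (rule sum.cong) (auto simp: deriv_D_theta_term e_def)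
  also have "\<dots> = (\<Sum>k<Suc d. e (Suc k) - e k)" by (simp only: lessThan_Suc_atMost)
  also have "\<dots> = e (Suc d) - e 0" by (rule sum_lessThan_telescope)
  also have "\<dots> = 0" using d by (simp add: e_def theta_boundary_def)
  finally have "var_x i ^ (a * d) * deriv_D a b (h_poly a b i :: 'k poly7) = 0"
    unfolding deriv_D_x_power_mult[symmetric] h by (simp add: deriv_D_x_power_mult)
  then show ?thesis by (simp add: kernel_D_def)
qed

section \<open>Generators of \<open>A\<close> and its inclusion in the kernel\<close>

lemma subalgebra_algebra_A: "subalgebra (algebra_A a b)"
  unfolding algebra_A_def by (rule subalgebra_hull)

lemma in_1_2_3: "(i :: 3) \<in> {1, 2, 3}"
  using UNIV_3_eq by blast

lemma x_in_algebra_A: "var_x i \<in> algebra_A a b"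
proof -
  have "var_x i \<in> {var_x 1, var_x 2, var_x 3}" using in_1_2_3[of i] by auto
  then show ?thesis unfolding algebra_A_def by (intro hull_inc) blast
qed

lemma h_poly_in_algebra_A: "h_poly a b i \<in> algebra_A a b"
proof -
  have "h_poly a b i \<in> {h_poly a b 1, h_poly a b 2, h_poly a b 3}" using in_1_2_3[of i] by auto
  then show ?thesis unfolding algebra_A_def by (intro hull_inc) blast
qed

text \<open>Antisymmetry and the vanishing diagonal extend the three listed generators to all index
  pairs, so that localizing at any \<open>x_i\<close> is handled uniformly.\<close>

lemma minor_in_algebra_A:
  "var_x i ^ a * var_y j - var_x j ^ a * var_y i \<in> (algebra_A a b :: 'k::field_char_0 poly7 set)"
proof -
  let ?m = "\<lambda>i j. var_x i ^ a * var_y j - var_x j ^ a * var_y i :: 'k poly7"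
  have "?m 1 2 \<in> algebra_A a b" "?m 1 3 \<in> algebra_A a b" "?m 2 3 \<in> algebra_A a b"
    unfolding algebra_A_def by (intro hull_inc; blast)+
  moreover from this[THEN subalgebra_uminus[OF subalgebra_algebra_A]]
  have "?m 2 1 \<in> algebra_A a b" "?m 3 1 \<in> algebra_A a b" "?m 3 2 \<in> algebra_A a b"
    by (simp_all only: minus_diff_eq)
  moreover have "?m i i \<in> algebra_A a b" for i
    using subalgebra_0[OF subalgebra_algebra_A] by simp
  ultimately show ?thesis
    using in_1_2_3[of i] in_1_2_3[of j] by auto
qed

lemma algebra_A_subset_kernel_D: "algebra_A a b \<subseteq> (kernel_D a b :: 'k::field_char_0 poly7 set)"
  unfolding algebra_A_def
proof (rule hull_minimal)
  show "subalgebra (kernel_D a b :: 'k poly7 set)" by (rule subalgebra_kernel_D)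
  have "var_x i \<in> (kernel_D a b :: 'k poly7 set)"
    "var_x i ^ a * var_y j - var_x j ^ a * var_y i \<in> (kernel_D a b :: 'k poly7 set)" for i j
    by (simp_all add: kernel_D_def deriv_D_diff deriv_D_mult)
  then show "{var_x 1, var_x 2, var_x 3,
      var_x 1 ^ a * var_y 2 - var_x 2 ^ a * var_y 1,
      var_x 1 ^ a * var_y 3 - var_x 3 ^ a * var_y 1,
      var_x 2 ^ a * var_y 3 - var_x 3 ^ a * var_y 2,
      h_poly a b 1, h_poly a b 2, h_poly a b 3} \<subseteq> (kernel_D a b :: 'k poly7 set)"
    using h_poly_in_kernel_D by blast
qed

lemma deriv_D_stable_xy:
  defines "T \<equiv> subalgebra hull (range var_x \<union> range var_y)"
  assumes f: "f \<in> T"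
  shows "deriv_D a b f \<in> (T :: 'k::field_char_0 poly7 set)"
proof -
  have T: "subalgebra T" unfolding T_def by (rule subalgebra_hull)
  have gens: "var_x i \<in> T" "var_y i \<in> T" for i unfolding T_def by (auto intro: hull_inc)
  have "f \<in> T \<and> deriv_D a b f \<in> T"
    using f[unfolded T_def]
  proof (rule hull_induct)
    fix g :: "'k poly7" assume "g \<in> range var_x \<union> range var_y"
    then show "g \<in> T \<and> deriv_D a b g \<in> T"
      using gens by (elim UnE imageE) (simp_all add: subalgebra_0[OF T] subalgebra_power[OF T])
  next
    show "subalgebra {g. g \<in> T \<and> deriv_D a b g \<in> T}"
      unfolding subalgebra_def
      by (auto simp: deriv_D_add deriv_D_mult intro: subalgebraD[OF T] subalgebra_0[OF T])
  qed
  then show ?thesis ..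
qed

text \<open>All terms of \<open>theta a b var_v\<close> beyond the constant one are free of
  \<open>v\<close>; this is what allows the relation for \<open>h_i\<close> to be solved for
  \<open>v\<close>.\<close>

lemma deriv_D_power_v_in_xy:
  "(deriv_D a b ^^ Suc k) var_v \<in> (subalgebra hull (range var_x \<union> range var_y) :: 'k::field_char_0 poly7 set)"
proof (induction k)
  case 0
  show ?case by (auto intro!: subalgebraD subalgebra_hull subalgebra_power intro: hull_inc)
qed (simp add: deriv_D_stable_xy)

text \<open>Since \<open>D y\<^sub>i = x\<^sub>i\<^sup>a\<close>, inverting \<open>x\<^sub>i\<close> makes \<open>y\<^sub>i\<close> a slice up to a unit: the ring of all
  polynomials becomes \<open>A[y\<^sub>i]\<close>, and the kernel becomes \<open>A\<close>.\<close>

lemma localization_eq_A_adjoin_y: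
  fixes f :: "'k::field_char_0 poly7"
  obtains M p where "\<forall>n. coeff p n \<in> algebra_A a b" and "var_x i ^ M * f = poly p (var_y i)"
proof -
  define A :: "'k poly7 set" where "A = algebra_A a b"
  \<comment> \<open>\<open>R\<close> is \<open>A[y_i]\<close> and \<open>S\<close> is the set of
    polynomials in \<open>R[1/x_i]\<close>; it remains to find every variable in
    \<open>S\<close>.\<close>
  define R where "R = {poly p (var_y i) | p. \<forall>n. coeff p n \<in> A}"
  define S where "S = {f. \<exists>M. var_x i ^ M * f \<in> R}"
  have A: "subalgebra A" unfolding A_def by (rule subalgebra_algebra_A)
  have R: "subalgebra R" unfolding R_def by (rule subalgebra_adjoin[OF A])
  have AR: "g \<in> R" if "g \<in> A" for g
  proof -
    have "g = poly [:g:] (var_y i)" "\<forall>n. coeff [:g:] n \<in> A"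
      using that A by (auto simp: coeff_pCons split: nat.split intro: subalgebra_0)
    then show ?thesis unfolding R_def by blast
  qed
  have yR: "var_y i \<in> R"
  proof -
    have "var_y i = poly [:0, 1:] (var_y i :: 'k poly7)" "\<forall>n. coeff [:0, 1:] n \<in> A"
      using A by (auto simp: coeff_pCons split: nat.split intro: subalgebra_0 subalgebra_1)
    then show ?thesis unfolding R_def by blast
  qed
  have xA: "var_x j \<in> A" for j unfolding A_def by (rule x_in_algebra_A)
  have S: "subalgebra S" unfolding S_def by (rule subalgebra_localization[OF R AR[OF xA]])
  have RS: "g \<in> S" if "g \<in> R" for g
  proof -
    have "var_x i ^ 0 * g \<in> R" using that by simp
    then show ?thesis unfolding S_def by blast
  qed
  have xS: "var_x j \<in> S" for j by (intro RS AR xA)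
  have yS: "var_y j \<in> S" for j
  proof -
    \<comment> \<open>The minor is solved for \<open>x_i^a * y_j\<close>.\<close>
    have "(var_x i ^ a * var_y j - var_x j ^ a * var_y i) + var_x j ^ a * var_y i \<in> R"
      by (intro subalgebraD[OF R] AR subalgebra_power[OF R] xA yR)
        (simp add: A_def minor_in_algebra_A)
    then have "var_x i ^ a * var_y j \<in> R" by simp
    then show ?thesis unfolding S_def by blast
  qed
  have xyS: "subalgebra hull (range var_x \<union> range var_y) \<subseteq> S"
    using xS yS by (intro hull_minimal S) auto
  have vS: "var_v \<in> S"
  proof -
    obtain d where h: "var_x i ^ (a * d) * (h_poly a b i :: 'k poly7) =
        var_x i ^ ((2 * b + 1) * a) * (\<Sum>k\<le>d. theta_term a b i d k)"
      by (rule x_power_mult_h_poly)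
    define N where "N = (2 * b + 1) * a"
    have "theta_term a b i d (Suc k) \<in> S" for k
      unfolding theta_term_def using deriv_D_power_v_in_xy xyS
      by (intro subalgebraD[OF S] subalgebra_power[OF S] subalgebra_uminus[OF S] xS yS) auto
    then have sum: "(\<Sum>k<d. theta_term a b i d (Suc k)) \<in> S" by (intro subalgebra_sum S)
    have "(\<Sum>k\<le>d. theta_term a b i d k)
        = var_v * var_x i ^ (a * d) + (\<Sum>k<d. theta_term a b i d (Suc k) :: 'k poly7)"
      by (simp add: sum.atMost_shift theta_term_def)
    with h have "var_x i ^ (a * d) * (h_poly a b i :: 'k poly7)
        = var_x i ^ N * (var_v * var_x i ^ (a * d) + (\<Sum>k<d. theta_term a b i d (Suc k)))"
      by (simp only: N_def)
    \<comment> \<open>The term \<open>k = 0\<close> is the only one containing \<open>v\<close> and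
      is isolated here; the rest lies in \<open>S\<close>, and membership in \<open>S\<close> is
      insensitive to powers of \<open>x_i\<close>.\<close>
    then have "var_x i ^ (N + a * d) * var_v =
        var_x i ^ (a * d) * (h_poly a b i :: 'k poly7) - var_x i ^ N * (\<Sum>k<d. theta_term a b i d (Suc k))"
      by (simp only: power_add distrib_left mult_ac add_diff_cancel_right')
    also have "\<dots> \<in> S"
      by (intro subalgebra_diff[OF S] subalgebraD[OF S] subalgebra_power[OF S] xS sum RS AR)
        (simp add: A_def h_poly_in_algebra_A)
    finally obtain M where "var_x i ^ M * (var_x i ^ (N + a * d) * var_v) \<in> R"
      unfolding S_def by blast
    then have "var_x i ^ (M + (N + a * d)) * var_v \<in> R" by (simp add: power_add mult.assoc)
    then show ?thesis unfolding S_def by blast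
  qed
  have "indet u \<in> S" for u by (cases u) (auto simp: xS yS vS)
  then have "S = UNIV" by (rule subalgebra_eq_UNIV[OF S])
  then obtain M where "var_x i ^ M * f \<in> R" unfolding S_def by blast
  then show thesis unfolding R_def A_def using that by blast
qed

text \<open>Some \<open>x_i^M * f\<close> is a polynomial in \<open>y_i\<close> over
  \<open>A\<close>. As a kernel element it equals its constant coefficient, which lies in
  \<open>A\<close>.\<close>

lemma kernel_D_x_power_mult_in_algebra_A:
  fixes f :: "'k::field_char_0 poly7"
  assumes f: "f \<in> kernel_D a b"
  obtains M where "var_x i ^ M * f \<in> algebra_A a b"
proof -
  obtain M p where p: "\<forall>n. coeff p n \<in> algebra_A a b" and M: "var_x i ^ M * f = poly p (var_y i)"
    by (rule localization_eq_A_adjoin_y)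
  have "var_x i ^ M * f \<in> kernel_D a b"
    using f by (simp add: kernel_D_def deriv_D_x_power_mult)
  then have "poly p (var_y i) = coeff p 0"
    unfolding M using p algebra_A_subset_kernel_D by (intro kernel_D_poly_y) blast+
  then show thesis using M p that by metis
qed

section \<open>Regular functions and separation\<close>

lemma ideal_of_self: "subalgebra A \<Longrightarrow> ideal_of A A"
  by (auto simp: ideal_of_def intro: subalgebraD subalgebra_0)

text \<open>This reduces a condition on all elements of a generated ideal to its generators. The
  multiplier \<open>c\<close> may lie outside \<open>A\<close>, as it may when a kernel element is
  tested against \<open>A\<close>.\<close>

lemma ideal_of_colon:
  assumes A: "subalgebra A" and J: "ideal_of A J"
  shows "ideal_of A {h \<in> A. c * h \<in> J}"
  using J subalgebra_0[OF A] subalgebraD[OF A]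
  by (auto simp: ideal_of_def distrib_left mult.left_commute[of c])

lemma ideal_power_subset:
  assumes A: "subalgebra A" and I: "I \<subseteq> A"
  shows "ideal_power A I r \<subseteq> A"
proof (induction r)
  case (Suc r)
  have "{f * g | f g. f \<in> I \<and> g \<in> ideal_power A I r} \<subseteq> A"
    using I Suc subalgebraD(3)[OF A] by blast
  then show ?case by (simp add: hull_minimal ideal_of_self[OF A])
qed simp

lemma power_in_ideal_power:
  assumes "subalgebra A" and "x \<in> I"
  shows "x ^ r \<in> ideal_power A I r"
proof (induction r)
  case (Suc r)
  then have "x ^ Suc r \<in> {f * g | f g. f \<in> I \<and> g \<in> ideal_power A I r}" using assms(2) by auto
  then show ?case unfolding ideal_power.simps by (rule hull_inc)
qed (simp add: subalgebra_1[OF assms(1)])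

text \<open>A pigeonhole argument: with no monomial prefix it says that the power
  \<open>3 * M + 1\<close> of the ideal lies in \<open>J\<close>. The prefix makes the induction
  work, each step moving one generator from the ideal power into the prefix.\<close>

lemma monomial_mult_ideal_power:
  assumes A: "subalgebra A" and J: "ideal_of A J"
    and x: "x \<in> A" "y \<in> A" "z \<in> A"
    and M: "x ^ M \<in> J" "y ^ M \<in> J" "z ^ M \<in> J"
    and g: "g \<in> ideal_power A (ideal_gen A {x, y, z}) r" and n: "n1 + n2 + n3 + r > 3 * M"
  shows "x ^ n1 * y ^ n2 * z ^ n3 * g \<in> J"
  using g n
proof (induction r arbitrary: g n1 n2 n3)
  case 0
  then have g: "g \<in> A" by simp
  note A_closed = subalgebraD(3)[OF A] subalgebra_power[OF A] x g
  have JA: "c * f \<in> J" if "c \<in> A" "f \<in> J" for c f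
    using J that by (auto simp: ideal_of_def)
  have split: "u ^ n = u ^ (n - M) * u ^ M" if "n \<ge> M" for u :: "'a poly7" and n
    using that by (simp flip: power_add)
  \<comment> \<open>Three exponents with sum above \<open>3 * M\<close> cannot all be below
    \<open>M\<close>.\<close>
  from 0 consider "n1 \<ge> M" | "n2 \<ge> M" | "n3 \<ge> M" by force
  then show ?case
  proof cases
    case 1
    have "(x ^ (n1 - M) * y ^ n2 * z ^ n3 * g) * x ^ M \<in> J" by (intro JA M A_closed)
    then show ?thesis unfolding split[OF 1, of x] by (simp only: mult_ac)
  next
    case 2
    have "(x ^ n1 * y ^ (n2 - M) * z ^ n3 * g) * y ^ M \<in> J" by (intro JA M A_closed)
    then show ?thesis unfolding split[OF 2, of y] by (simp only: mult_ac)
  next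
    case 3
    have "(x ^ n1 * y ^ n2 * z ^ (n3 - M) * g) * z ^ M \<in> J" by (intro JA M A_closed)
    then show ?thesis unfolding split[OF 3, of z] by (simp only: mult_ac)
  qed
next
  case (Suc r)
  define I where "I = ideal_gen A {x, y, z}"
  have IA: "I \<subseteq> A" unfolding I_def using x by (intro hull_minimal ideal_of_self A) auto
  define K where "K = {h \<in> A. x ^ n1 * y ^ n2 * z ^ n3 * h \<in> J}"
  have "f * h \<in> K" if f: "f \<in> I" and h: "h \<in> ideal_power A I r" for f h
  proof -
    have hA: "h \<in> A" using h ideal_power_subset[OF A IA] by blast
    \<comment> \<open>With \<open>h\<close> fixed, the condition on \<open>f\<close> defines an
      ideal, so only \<open>x\<close>, \<open>y\<close>, \<open>z\<close> need checking; each raises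
      one prefix exponent.\<close>
    have "I \<subseteq> {f \<in> A. (x ^ n1 * y ^ n2 * z ^ n3 * h) * f \<in> J}"
      unfolding I_def
    proof (rule hull_minimal)
      show "ideal_of A {f \<in> A. (x ^ n1 * y ^ n2 * z ^ n3 * h) * f \<in> J}"
        by (rule ideal_of_colon[OF A J])
      have "x ^ Suc n1 * y ^ n2 * z ^ n3 * h \<in> J" "x ^ n1 * y ^ Suc n2 * z ^ n3 * h \<in> J"
        "x ^ n1 * y ^ n2 * z ^ Suc n3 * h \<in> J"
        using Suc.prems(2) by (intro Suc.IH[OF h[unfolded I_def]]; simp)+
      then show "{x, y, z} \<subseteq> {f \<in> A. (x ^ n1 * y ^ n2 * z ^ n3 * h) * f \<in> J}"
        using x by (simp add: mult_ac)
    qed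
    then have "(x ^ n1 * y ^ n2 * z ^ n3 * h) * f \<in> J" using f by blast
    then have "x ^ n1 * y ^ n2 * z ^ n3 * (f * h) \<in> J" by (simp only: mult_ac)
    then show ?thesis using f IA hA subalgebraD(3)[OF A] unfolding K_def by blast
  qed
  then have "ideal_power A I (Suc r) \<subseteq> K"
    unfolding ideal_power.simps K_def by (intro hull_minimal ideal_of_colon A J) blast
  then show ?case using Suc.prems(1) unfolding I_def[symmetric] K_def by blast
qed

text \<open>Coprimality of powers of distinct variables, read off monomials: multiplying
  \<open>q\<close> by \<open>x_j^r\<close> leaves every exponent of \<open>x_i\<close>
  unchanged.\<close>

lemma x_power_dvd_cancel:
  fixes p q :: "'k::comm_semiring_1 poly7"
  assumes "i \<noteq> j" and eq: "var_x i ^ r * p = var_x j ^ r * q"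
  shows "var_x i ^ r dvd q"
proof (rule indet_power_dvd)
  fix m assume m: "m \<in> Poly_Mapping.keys q"
  show "r \<le> Poly_Mapping.lookup m (Vx i)"
  proof (rule ccontr)
    assume "\<not> ?thesis"
    then have "Poly_Mapping.lookup (Poly_Mapping.single (Vx j) r + m) (Vx i)
        < Poly_Mapping.lookup (Poly_Mapping.single (Vx i) r) (Vx i)"
      using assms(1) by (simp add: lookup_add lookup_single)
    then have "Poly_Mapping.lookup (var_x i ^ r * p) (Poly_Mapping.single (Vx j) r + m) = 0"
      unfolding indet_power by (rule lookup_single_mult_eq_0)
    then have "Poly_Mapping.lookup q m = 0"
      unfolding eq unfolding indet_power lookup_single_mult_add by simp
    with m show False by (simp add: in_keys_iff)
  qed
qed

lemma kernel_D_x_powers_mult_in_algebra_A: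
  fixes f :: "'k::field_char_0 poly7"
  assumes "f \<in> kernel_D a b"
  obtains M where "\<And>i. var_x i ^ M * f \<in> algebra_A a b"
proof -
  have "\<forall>i. \<exists>M. var_x i ^ M * f \<in> algebra_A a b"
    using kernel_D_x_power_mult_in_algebra_A[OF assms] by metis
  then obtain M where M: "\<And>i. var_x i ^ M i * f \<in> algebra_A a b" by metis
  \<comment> \<open>The sum dominates all three exponents, and the surplus power of
    \<open>x_i\<close> lies in \<open>A\<close>.\<close>
  have "var_x i ^ (\<Sum>j\<in>UNIV. M j) * f \<in> algebra_A a b" for i
  proof -
    have "M i \<le> (\<Sum>j\<in>UNIV. M j)" by (simp add: member_le_sum)
    then have "var_x i ^ (\<Sum>j\<in>UNIV. M j) = (var_x i ^ ((\<Sum>j\<in>UNIV. M j) - M i) * var_x i ^ M i :: 'k poly7)"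
      by (simp flip: power_add)
    moreover have "var_x i ^ ((\<Sum>j\<in>UNIV. M j) - M i) * (var_x i ^ M i * f) \<in> algebra_A a b"
      by (intro subalgebraD(3)[OF subalgebra_algebra_A] subalgebra_power[OF subalgebra_algebra_A]
          x_in_algebra_A M)
    ultimately show ?thesis by (simp only: mult.assoc)
  qed
  then show thesis by (rule that)
qed

lemma kernel_D_subset_colon_infinity:
  fixes f :: "'k::field_char_0 poly7"
  assumes f: "f \<in> kernel_D a b"
  shows "to_fract f
    \<in> colon_infinity (algebra_A a b) (ideal_gen (algebra_A a b) {var_x 1, var_x 2, var_x 3})"
proof -
  define A :: "'k poly7 set" where "A = algebra_A a b"
  define I where "I = ideal_gen A {var_x 1, var_x 2, var_x 3}"
  have A: "subalgebra A" unfolding A_def by (rule subalgebra_algebra_A)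
  have x: "var_x i \<in> A" for i unfolding A_def by (rule x_in_algebra_A)
  obtain M where M: "\<And>i. var_x i ^ M * f \<in> A"
    using kernel_D_x_powers_mult_in_algebra_A[OF f] unfolding A_def by blast
  have "to_fract f = Fract (var_x 1 ^ M * f) (var_x 1 ^ M)"
    by (simp add: Fract_conv_to_fract)
  then have "to_fract f \<in> quotient_field A"
    unfolding quotient_field_def using M[of 1] subalgebra_power[OF A x[of 1], of M] by force
  moreover have "to_fract f * to_fract g \<in> to_fract ` A" if "g \<in> ideal_power A I (3 * M + 1)" for g
  proof -
    define J where "J = {h \<in> A. f * h \<in> A}"
    have J: "ideal_of A J" unfolding J_def by (rule ideal_of_colon[OF A ideal_of_self[OF A]])
    have xJ: "var_x i ^ M \<in> J" for i
      using M[of i] subalgebra_power[OF A x[of i], of M] by (simp add: J_def mult.commute)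
    \<comment> \<open>The pigeonhole bound with empty prefix explains the exponent
      \<open>3 * M + 1\<close>.\<close>
    have "var_x 1 ^ 0 * var_x 2 ^ 0 * var_x 3 ^ 0 * g \<in> J"
      by (rule monomial_mult_ideal_power[OF A J x x x xJ xJ xJ that[unfolded I_def]]) simp
    then have "f * g \<in> A" by (simp add: J_def)
    then show ?thesis by (simp only: to_fract_mult[symmetric] imageI)
  qed
  ultimately show ?thesis
    unfolding colon_infinity_def A_def[symmetric] I_def[symmetric]
    by (intro CollectI conjI exI[of _ "3 * M + 1"]) auto
qed

lemma colon_infinity_subset_kernel_D:
  fixes \<phi> :: "'k::field_char_0 poly7 fract"
  assumes "\<phi> \<in> colon_infinity (algebra_A a b) (ideal_gen (algebra_A a b) {var_x 1, var_x 2, var_x 3})"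
  shows "\<phi> \<in> to_fract ` kernel_D a b"
proof -
  define A :: "'k poly7 set" where "A = algebra_A a b"
  define I where "I = ideal_gen A {var_x 1, var_x 2, var_x 3}"
  have A: "subalgebra A" unfolding A_def by (rule subalgebra_algebra_A)
  obtain r where r: "\<And>g. g \<in> ideal_power A I r \<Longrightarrow> \<phi> * to_fract g \<in> to_fract ` A"
    using assms unfolding colon_infinity_def A_def[symmetric] I_def[symmetric] by blast
  have "\<phi> * to_fract (var_x 1 ^ r) \<in> to_fract ` A" "\<phi> * to_fract (var_x 2 ^ r) \<in> to_fract ` A"
    unfolding I_def by (intro r[unfolded I_def] power_in_ideal_power A hull_inc; simp)+
  then obtain p q where p: "\<phi> * to_fract (var_x 1 ^ r) = to_fract p" "p \<in> A"
    and q: "\<phi> * to_fract (var_x 2 ^ r) = to_fract q"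
    by blast
  \<comment> \<open>Comparing the denominators \<open>x_1^r\<close> and \<open>x_2^r\<close> of
    \<open>\<phi>\<close> shows that \<open>x_1^r\<close> divides \<open>p\<close>, so
    \<open>\<phi>\<close> is a polynomial.\<close>
  have "to_fract (var_x 1 ^ r * q) = \<phi> * to_fract (var_x 1 ^ r) * to_fract (var_x 2 ^ r)"
    unfolding to_fract_mult q[symmetric] by (simp only: mult_ac)
  also have "\<dots> = to_fract (var_x 2 ^ r * p)"
    unfolding p to_fract_mult by (simp only: mult_ac)
  finally have "var_x 1 ^ r * q = var_x 2 ^ r * p" by (simp only: to_fract_eq_iff)
  then have "var_x 1 ^ r dvd p" by (intro x_power_dvd_cancel[of 1 2]) simp
  then obtain g where g: "p = var_x 1 ^ r * g" ..
  have "\<phi> * to_fract (var_x 1 ^ r) = to_fract g * to_fract (var_x 1 ^ r)"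
    unfolding p g to_fract_mult by (rule mult.commute)
  moreover have "to_fract (var_x 1 ^ r :: 'k poly7) \<noteq> 0"
    by (simp only: to_fract_eq_0_iff power_eq_0_iff indet_neq_0) simp
  ultimately have "\<phi> = to_fract g" by (simp only: mult_cancel_right) simp
  moreover have "deriv_D a b p = 0"
    using p(2) algebra_A_subset_kernel_D by (auto simp: A_def kernel_D_def)
  then have "g \<in> kernel_D a b" unfolding g kernel_D_def by (simp add: deriv_D_x_power_mult)
  ultimately show ?thesis by blast
qed

section \<open>Evaluation at points\<close>

lemma finite_UNIV_var: "finite (UNIV :: var set)"
proof -
  have "u \<in> range Vx \<union> range Vy \<union> {Vv}" for u by (cases u) auto
  then have "UNIV = range Vx \<union> range Vy \<union> {Vv}" by blast
  then show ?thesis by (metis finite finite.emptyI finite_Un finite_imageI finite_insert)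
qed

text \<open>The product runs over all variables instead of the support, so that multiplicativity
  needs no comparison of supports.\<close>

definition eval_mon :: "(var \<Rightarrow> 'k::comm_semiring_1) \<Rightarrow> monomial \<Rightarrow> 'k" where
  "eval_mon p m = (\<Prod>u\<in>UNIV. p u ^ Poly_Mapping.lookup m u)"

lemma eval_mon_add: "eval_mon p (m + n) = eval_mon p m * eval_mon p n"
  by (simp add: eval_mon_def lookup_add power_add prod.distrib)

lemma eval_mon_single: "eval_mon p (Poly_Mapping.single u n) = p u ^ n"
proof -
  have "p w ^ Poly_Mapping.lookup (Poly_Mapping.single u n) w = (if w = u then p u ^ n else 1)" for w
    by (simp add: lookup_single)
  then show ?thesis by (simp add: eval_mon_def prod.delta finite_UNIV_var)
qed

lemma eval_at_superset:
  assumes "finite K" and "Poly_Mapping.keys f \<subseteq> K"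
  shows "eval_at f p = (\<Sum>m\<in>K. Poly_Mapping.lookup f m * eval_mon p m)"
proof -
  have "(\<Prod>u\<in>Poly_Mapping.keys m. p u ^ Poly_Mapping.lookup m u) = eval_mon p m" for m
    unfolding eval_mon_def
    by (rule prod.mono_neutral_left) (auto simp: finite_UNIV_var in_keys_iff)
  then show ?thesis
    unfolding eval_at_def using assms
    by (simp only:) (rule sum.mono_neutral_left, auto simp: in_keys_iff)
qed

lemma eval_at_add: "eval_at (f + g) p = eval_at f p + eval_at g p"
  by (simp add: eval_at_superset[of "Poly_Mapping.keys f \<union> Poly_Mapping.keys g"] keys_add
      lookup_add distrib_right sum.distrib)

lemma eval_at_single: "eval_at (Poly_Mapping.single m c) p = c * eval_mon p m"
  by (simp add: eval_at_superset[of "{m}"])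

lemma eval_at_0: "eval_at 0 p = 0"
  by (simp add: eval_at_def)

lemma eval_at_single_mult:
  "eval_at (Poly_Mapping.single m c * f) p = c * eval_mon p m * eval_at f p"
  by (induction f rule: poly7_induct)
    (simp_all add: eval_at_0 mult_single eval_at_single eval_mon_add distrib_left eval_at_add mult.assoc
      mult.left_commute)

lemma eval_at_indet: "eval_at (indet u) p = p u"
  by (simp add: indet_def eval_at_single eval_mon_single)

lemma eval_at_indet_power_mult: "eval_at (indet u ^ n * f) p = p u ^ n * eval_at f p"
  by (simp add: indet_power eval_at_single_mult eval_mon_single)

lemma separating_algebra_A:
  assumes "a \<ge> 1" and "b \<ge> 1"
  shows "separating_algebra (kernel_D a b :: 'k::field_char_0 poly7 set) (algebra_A a b)"
  unfolding separating_algebra_def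
proof (intro conjI allI impI subalgebra_algebra_A algebra_A_subset_kernel_D)
  fix p q :: "var \<Rightarrow> 'k"
  assume "\<exists>f\<in>kernel_D a b. eval_at f p \<noteq> eval_at f q"
  then obtain f where f: "f \<in> kernel_D a b" and neq: "eval_at f p \<noteq> eval_at f q" by blast
  show "\<exists>g\<in>algebra_A a b. eval_at g p \<noteq> eval_at g q"
  proof (rule ccontr)
    assume "\<not> ?thesis"
    then have eq: "eval_at g p = eval_at g q" if "g \<in> algebra_A a b" for g using that by blast
    have x: "p (Vx i) = q (Vx i)" for i
      using eq[OF x_in_algebra_A[of i]] by (simp add: eval_at_indet)
    obtain M where M: "\<And>i. var_x i ^ M * f \<in> algebra_A a b"
      using kernel_D_x_powers_mult_in_algebra_A[OF f] by blast
    \<comment> \<open>Since \<open>x_i^M * f\<close> takes equal values at \<open>p\<close> and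
      \<open>q\<close>, a nonzero common coordinate could be cancelled and would give equal values
      of \<open>f\<close>.\<close>
    have zero: "p (Vx i) = 0" for i
      using eq[OF M[of i]] x[of i] neq by (auto simp: eval_at_indet_power_mult)
    have "eval_at f p = eval_at f q"
      using kernel_D_eval_at_const[OF assms f] zero x by metis
    with neq show False ..
  qed
qed

theorem mainTheorem3:
  fixes a b :: nat
  assumes "a \<ge> 1" and "b \<ge> 1"
  shows "to_fract ` (kernel_D a b :: 'k::{alg_closed_field, field_char_0} poly7 set)
           = colon_infinity (algebra_A a b) (ideal_gen (algebra_A a b) {var_x 1, var_x 2, var_x 3})
    \<and> separating_algebra (kernel_D a b :: 'k poly7 set) (algebra_A a b)"
  using kernel_D_subset_colon_infinity colon_infinity_subset_kernel_D separating_algebra_A[OF assms]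
  by blast

end
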